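(* Let $0<\lambda<\nu$ and $x\in\mathbb{N}$. Let $(X_t^{x+1})_{t\ge0}$ be the positive recurrent $M/M/1$ process with rates $\lambda,\nu$ started at $x+1$, and let $T_0^{x+1}=\inf\{t>0:X_t^{x+1}=0\}$. Let $u_y=u(y)=(\nu/\lambda)^{y/2}\ge1$ for $y\in\mathbb{N}$, and let $(X_{u,t}^x)_{t\ge0}$ be the $u$-modification process started at $x$. Then for any $t\ge0$, $$\mathbb{P}(T_0^{x+1}>t)=u_x\,e^{-t(\sqrt\lambda-\sqrt\nu)^2}\,\mathbb{E}\left[\frac1{u(X_{u,t}^x)}\exp\left(-\sqrt{\lambda\nu}\int_0^t\mathbf{1}_{\{0\}}(X_{u,s}^x)\,ds\right)\right]\le u_x\,e^{-t(\sqrt\lambda-\sqrt\nu)^2}.$$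
   Context: $\mathbb{N}=\{0,1,2,\dots\}$. A birth--death process with birth rates $\lambda_x$ and death rates $\nu_x$ is the continuous-time Markov chain on $\mathbb{N}$ jumping from $x$ to $x+1$ at rate $\lambda_x$ and from $x$ to $x-1$ at rate $\nu_x$ (with $\nu_0=0$). The $M/M/1$ process with rates $\lambda,\nu$ is the birth--death process with $\lambda_x=\lambda$ for all $x$ and $\nu_x=\nu\mathbf{1}_{\{x\ge1\}}$. For a positive function $u$ on $\mathbb{N}$, the $u$-modification of a birth--death process with rates $\lambda_x,\nu_x$ is the birth--death process with birth rates $\lambda^u_x=\frac{u_{x+1}}{u_x}\lambda_{x+1}$ and death rates $\nu^u_x=\frac{u_{x-1}}{u_x}\nu_x$ (with $\nu^u_0=0$). *)

theory Defs
  imports "HOL-Probability.Probability"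
begin

text \<open>
  The entry \<open>birth_death_rate b d x y\<close> is the rate of jumping from \<open>x\<close> to \<open>y\<close> if \<open>x \<noteq> y\<close>, and
  minus the total rate of leaving \<open>x\<close> if \<open>x = y\<close>.  It is meant for \<open>d 0 = 0\<close>.
\<close>

definition birth_death_rate :: "(nat \<Rightarrow> real) \<Rightarrow> (nat \<Rightarrow> real) \<Rightarrow> nat \<Rightarrow> nat \<Rightarrow> real" where
  "birth_death_rate b d x y =
     (if y = x + 1 then b x
      else if x = y + 1 then d x
      else if y = x then - (b x + d x)
      else 0)"

text \<open>
  The kernel \<open>P t x\<close> is the law at time \<open>t \<ge> 0\<close> of the chain started at \<open>x\<close>; its values at
  negative times play no role.
\<close>

definition transition_semigroup ::
    "(nat \<Rightarrow> nat \<Rightarrow> real) \<Rightarrow> (real \<Rightarrow> nat \<Rightarrow> nat pmf) \<Rightarrow> bool" where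
  "transition_semigroup q P \<longleftrightarrow>
     (\<forall>x. P 0 x = return_pmf x) \<and>
     (\<forall>s\<ge>0. \<forall>t\<ge>0. \<forall>x. P (s + t) x = bind_pmf (P s x) (P t)) \<and>
     (\<forall>x y. ((\<lambda>t. pmf (P t x) y) has_real_derivative q x y) (at 0 within {0..}))"

definition natural_filtration :: "'a measure \<Rightarrow> (real \<Rightarrow> 'a \<Rightarrow> nat) \<Rightarrow> real \<Rightarrow> 'a measure" where
  "natural_filtration M X s =
     sigma (space M) {X r -` B \<inter> space M | r B. 0 \<le> r \<and> r \<le> s}"

text \<open>
  The Markov property
  \<open>P(X\<^bsub>s+t\<^esub> = y | F\<^sub>s) = P\<^sub>t(X\<^sub>s, y)\<close>, with the conditional
  probability written out on the events \<open>A \<inter> {X\<^sub>s = x}\<close>, \<open>A \<in> F\<^sub>s\<close>.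
\<close>

definition markov_property ::
    "'a measure \<Rightarrow> (real \<Rightarrow> 'a \<Rightarrow> nat) \<Rightarrow> (real \<Rightarrow> nat \<Rightarrow> nat pmf) \<Rightarrow> bool" where
  "markov_property M X P \<longleftrightarrow>
     (\<forall>s\<ge>0. \<forall>t\<ge>0. \<forall>A \<in> sets (natural_filtration M X s). \<forall>x y.
        measure M {\<omega> \<in> A. X s \<omega> = x \<and> X (s + t) \<omega> = y} =
        measure M {\<omega> \<in> A. X s \<omega> = x} * pmf (P t x) y)"

text \<open>
  A realisation of the birth--death process with birth rates \<open>b\<close> and death rates \<open>d\<close>, started
  at \<open>x0\<close>.  The topology on \<^typ>\<open>nat\<close> is discrete, so left limits in \<^typ>\<open>nat\<close> mean that a path makes
  only finitely many jumps in bounded time: the process does not explode, and its law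
  is determined by the rates.
\<close>

locale birth_death_process = prob_space M
  for M :: "'a measure" +
  fixes b d :: "nat \<Rightarrow> real" and x0 :: nat and X :: "real \<Rightarrow> 'a \<Rightarrow> nat"
  assumes birth_nonneg: "0 \<le> b x"
    and death_nonneg: "0 \<le> d x"
    and death_0: "d 0 = 0"
    and measurable_X: "0 \<le> t \<Longrightarrow> X t \<in> measurable M (count_space UNIV)"
    and right_continuous:
      "\<omega> \<in> space M \<Longrightarrow> 0 \<le> t \<Longrightarrow> continuous (at_right t) (\<lambda>s. X s \<omega>)"
    and left_limits:
      "\<omega> \<in> space M \<Longrightarrow> 0 < t \<Longrightarrow> \<exists>l. ((\<lambda>s. X s \<omega>) \<longlongrightarrow> l) (at_left t)"
    and start: "AE \<omega> in M. X 0 \<omega> = x0"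
    and markov:
      "\<exists>P. transition_semigroup (birth_death_rate b d) P \<and> markov_property M X P"

definition mm1_birth :: "real \<Rightarrow> nat \<Rightarrow> real" where
  "mm1_birth lam = (\<lambda>x. lam)"

definition mm1_death :: "real \<Rightarrow> nat \<Rightarrow> real" where
  "mm1_death nu = (\<lambda>x. nu * indicator {1..} x)"

definition modified_birth :: "(nat \<Rightarrow> real) \<Rightarrow> (nat \<Rightarrow> real) \<Rightarrow> nat \<Rightarrow> real" where
  "modified_birth u b = (\<lambda>x. u (x + 1) / u x * b (x + 1))"

definition modified_death :: "(nat \<Rightarrow> real) \<Rightarrow> (nat \<Rightarrow> real) \<Rightarrow> nat \<Rightarrow> real" where
  "modified_death u d = (\<lambda>x. if x = 0 then 0 else u (x - 1) / u x * d x)"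

text \<open>The value is \<open>\<infinity>\<close> on paths that never visit \<open>0\<close> at a positive time.\<close>

definition hitting_time_0 :: "(real \<Rightarrow> 'a \<Rightarrow> nat) \<Rightarrow> 'a \<Rightarrow> ereal" where
  "hitting_time_0 X \<omega> = Inf (ereal ` {t. 0 < t \<and> X t \<omega> = 0})"

end

theory Submission imports Defs
begin

text \<open>
  Let \<open>r = sqrt (lam * nu)\<close> and \<open>c = (sqrt lam - sqrt nu)\<^sup>2 = lam + nu - 2 * r\<close>.  Survival of the
  M/M/1 process started at \<open>x + 1\<close> is governed by its generator killed in \<open>0\<close>.  After relabelling the
  states this is the operator
  \<open>A f x = lam * f (x + 1) + nu * f (x - 1) - (lam + nu) * f x\<close> with \<open>f (-1) = 0\<close>.
  Conjugating with \<open>u\<close> replaces both \<open>lam\<close> and \<open>nu\<close> in front of the neighbours by \<open>r\<close>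
  (\<open>euler_step_intertwining\<close>).  The result is the generator of the \<open>u\<close>-modification, a symmetric walk
  with rates \<open>r\<close> reflected at \<open>0\<close>, killed at the rate \<open>c + r * indicator {0} x\<close>.  The constant \<open>c\<close> gives
  the exponential factor, the killing in \<open>0\<close> gives the occupation time of \<open>0\<close> by Feynman--Kac, and
  applying the conjugated semigroup to the constant \<open>1 = u * (1 / u)\<close> gives \<open>u x\<close> and \<open>1 / u\<close>.
  The inequality holds because the integrand is at most \<open>1\<close>.

  Neither exponentials of operators nor differential equations are used.  Both sides are written as
  limits of the same iterates of Euler steps \<open>(I + t/n A)\<^sup>n\<close> (\<open>survival_limit\<close> and
  \<open>feynman_kac_limit\<close>), and the intertwining holds exactly for each Euler step.
  The limits come from observing the process at the times \<open>k * t / n\<close>: by the Markov property, the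
  expectation of a product over these times is an iterated one-step operator
  (\<open>expectation_skeleton\<close>), and iterated contractions that differ by \<open>O(1/n\<^sup>2)\<close> in each step differ
  by \<open>O(1/n)\<close> after \<open>n\<close> steps (\<open>iterates_close\<close>).  As \<open>n\<close> grows, right continuity of the paths
  recovers the hitting time and the occupation time.

  The analytic input is that a transition semigroup with bounded rates satisfies
  \<open>P t = I + t Q + O(t\<^sup>2)\<close> uniformly in the starting point (\<open>avg_first_order\<close>), although only the
  entrywise derivatives at time \<open>0\<close> are given.  Subadditivity bounds the probability of leaving the
  starting point by \<open>t * q\<close>; hence \<open>P t - I\<close> is \<open>O(t)\<close> uniformly, \<open>P t - I\<close> and \<open>n (P (t/n) - I)\<close>
  differ by \<open>O(t\<^sup>2)\<close> uniformly in \<open>n\<close>, and the latter converges to \<open>t Q\<close>.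
\<close>

section \<open>Transition semigroups with bounded rates\<close>

text \<open>
  The generator of the birth--death process that is moreover killed at rate \<open>V x\<close> while in \<open>x\<close>.
  At \<open>x = 0\<close> the truncated \<open>x - 1\<close> is harmless, because it only occurs next to \<open>d 0 = 0\<close>.
\<close>
definition killed_generator ::
    "(nat \<Rightarrow> real) \<Rightarrow> (nat \<Rightarrow> real) \<Rightarrow> (nat \<Rightarrow> real) \<Rightarrow> (nat \<Rightarrow> real) \<Rightarrow> nat \<Rightarrow> real" where
  "killed_generator b d V f x = b x * f (x + 1) + d x * f (x - 1) - (b x + d x + V x) * f x"

lemma right_derivative_sequence:
  fixes f :: "real \<Rightarrow> real"
  assumes "(f has_real_derivative D) (at 0 within {0..})" and "0 \<le> t"
  shows "(\<lambda>n. real n * (f (t / real n) - f 0)) \<longlonglongrightarrow> t * D"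
proof (cases "t = 0")
  case False
  with assms have t: "0 < t" by simp
  have lim: "((\<lambda>y. (f y - f 0) / y) \<longlongrightarrow> D) (at 0 within {0..})"
    using assms(1) by (simp add: has_field_derivative_iff)
  have "(\<lambda>n. t / real n) \<longlonglongrightarrow> 0"
    by (rule lim_const_over_n)
  then have "filterlim (\<lambda>n. t / real n) (at 0 within {0..}) sequentially"
    unfolding filterlim_at
    by (simp add: t less_imp_le) (use t in \<open>auto simp: eventually_sequentially intro!: exI[of _ 1]\<close>)
  from tendsto_mult_left[OF filterlim_compose[OF lim this], of t]
  have "(\<lambda>n. t * ((f (t / real n) - f 0) / (t / real n))) \<longlonglongrightarrow> t * D" .
  then show ?thesis
    by (rule Lim_transform_eventually)
      (use t in \<open>auto simp: eventually_sequentially field_simps intro!: exI[of _ 1]\<close>)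
qed simp

lemma integrable_pmf_bounded:
  fixes f :: "'a \<Rightarrow> real"
  assumes "\<And>x. \<bar>f x\<bar> \<le> B"
  shows "integrable (measure_pmf p) f"
  by (rule measure_pmf.integrable_const_bound[where B = B]) (auto simp: assms)

lemma abs_expectation_pmf_le:
  fixes f :: "'a \<Rightarrow> real"
  assumes "\<And>x. \<bar>f x\<bar> \<le> B"
  shows "\<bar>measure_pmf.expectation p f\<bar> \<le> B"
  by (rule order_trans[OF integral_abs_bound measure_pmf.integral_le_const])
    (auto intro!: integrable_pmf_bounded assms simp: assms)

lemma expectation_bind_pmf:
  fixes f :: "'b \<Rightarrow> real"
  assumes "\<And>y. \<bar>f y\<bar> \<le> B"
  shows "measure_pmf.expectation (bind_pmf p k) f
    = measure_pmf.expectation p (\<lambda>x. measure_pmf.expectation (k x) f)"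
  unfolding measure_pmf_bind
  by (rule integral_bind[where K = "count_space UNIV" and B = B and B' = 1])
    (auto simp: assms measure_pmf_in_subprob_algebra measure_pmf.emeasure_space_1
      measure_pmf.finite_measure_axioms space_subprob_algebra
      intro!: measure_pmf.subprob_space_axioms)

locale bounded_semigroup =
  fixes b d :: "nat \<Rightarrow> real" and q :: real and P :: "real \<Rightarrow> nat \<Rightarrow> nat pmf"
  assumes b_nonneg: "0 \<le> b x" and d_nonneg: "0 \<le> d x" and d_0: "d 0 = 0"
    and rate_le: "b x + d x \<le> q"
    and semigroup: "transition_semigroup (birth_death_rate b d) P"
begin

definition avg :: "real \<Rightarrow> (nat \<Rightarrow> real) \<Rightarrow> nat \<Rightarrow> real" where
  "avg t f x = measure_pmf.expectation (P t x) f"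

lemma P_0: "P 0 x = return_pmf x"
  and P_add: "0 \<le> s \<Longrightarrow> 0 \<le> t \<Longrightarrow> P (s + t) x = bind_pmf (P s x) (P t)"
  and P_deriv: "((\<lambda>t. pmf (P t x) y) has_real_derivative birth_death_rate b d x y)
     (at 0 within {0..})"
  using semigroup by (simp_all add: transition_semigroup_def)

lemma q_nonneg: "0 \<le> q"
  using rate_le[of 0] b_nonneg[of 0] d_nonneg[of 0] by linarith

lemma avg_0: "avg 0 f = f"
  by (simp add: avg_def P_0 fun_eq_iff)

lemma avg_bound: "(\<And>y. \<bar>f y\<bar> \<le> B) \<Longrightarrow> \<bar>avg t f x\<bar> \<le> B"
  unfolding avg_def by (rule abs_expectation_pmf_le)

lemma avg_diff:
  assumes "\<And>y. \<bar>f y\<bar> \<le> B" "\<And>y. \<bar>g y\<bar> \<le> C"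
  shows "avg t (\<lambda>y. f y - g y) x = avg t f x - avg t g x"
  unfolding avg_def
  by (intro Bochner_Integration.integral_diff integrable_pmf_bounded[OF assms(1)]
      integrable_pmf_bounded[OF assms(2)])

lemma avg_cmult: "avg t (\<lambda>y. c * f y) x = c * avg t f x"
  unfolding avg_def by simp

lemma avg_add_time:
  assumes "0 \<le> s" "0 \<le> t" "\<And>y. \<bar>f y\<bar> \<le> B"
  shows "avg (s + t) f x = avg s (avg t f) x"
  unfolding avg_def P_add[OF assms(1,2)]
  by (subst expectation_bind_pmf[where B = B]) (auto simp: assms avg_def)

lemma pmf_P_submult:
  assumes "0 \<le> s" "0 \<le> t"
  shows "pmf (P s x) x * pmf (P t x) x \<le> pmf (P (s + t) x) x"
proof -
  have "pmf (P s x) x * pmf (P t x) x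
      = measure_pmf.expectation (P s x) (\<lambda>y. indicator {x} y * pmf (P t x) x)"
    by (simp add: measure_pmf_single)
  also have "\<dots> \<le> measure_pmf.expectation (P s x) (\<lambda>y. pmf (P t y) x)"
    by (intro integral_mono integrable_pmf_bounded[where B = 1])
      (auto simp: indicator_def pmf_le_1)
  also have "\<dots> = pmf (P (s + t) x) x"
    by (simp add: P_add[OF assms] pmf_bind)
  finally show ?thesis .
qed

text \<open>
  The definition of a transition semigroup gives derivatives at time \<open>0\<close> separately for each pair of
  states.  This bound is where they become uniform in the state: \<open>- ln (pmf (P t x) x)\<close> is subadditive
  in \<open>t\<close>, so that its growth is controlled by its derivative at \<open>0\<close>.
\<close>
lemma exit_probability_le:
  assumes t: "0 \<le> t"
  shows "1 - pmf (P t x) x \<le> t * q"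
proof -
  \<comment> \<open>Returning is at least as likely as staying at all grid times, and by Bernoulli's inequality
    staying costs at most \<open>n\<close> times the cost of one step.\<close>
  have power: "pmf (P h x) x ^ n \<le> pmf (P (real n * h) x) x" if "0 \<le> h" for h n
  proof (induction n)
    case (Suc n)
    have "pmf (P h x) x ^ Suc n \<le> pmf (P h x) x * pmf (P (real n * h) x) x"
      using Suc by (simp add: mult_left_mono)
    also have "\<dots> \<le> pmf (P (h + real n * h) x) x"
      using that by (intro pmf_P_submult) auto
    finally show ?case by (simp add: algebra_simps)
  qed (simp add: P_0)
  \<comment> \<open>Letting \<open>n\<close> tend to infinity turns the right-hand side into \<open>t\<close> times the jump rate.\<close>
  have step: "1 - pmf (P t x) x \<le> - (real n * (pmf (P (t / real n) x) x - pmf (P 0 x) x))"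
    if "1 \<le> n" for n
  proof -
    have "1 + real n * (pmf (P (t / real n) x) x - 1) \<le> pmf (P (t / real n) x) x ^ n"
      using Bernoulli_inequality[of "pmf (P (t / real n) x) x - 1" n] by simp
    also have "\<dots> \<le> pmf (P t x) x"
      using power[of "t / real n" n] that t by simp
    finally show ?thesis by (simp add: P_0)
  qed
  have "1 - pmf (P t x) x \<le> - (t * birth_death_rate b d x x)"
    by (rule LIMSEQ_le_const[OF tendsto_minus[OF right_derivative_sequence[OF P_deriv t]]])
      (use step in blast)
  also have "\<dots> \<le> t * q"
    using mult_left_mono[OF rate_le[of x] t] by (simp add: birth_death_rate_def algebra_simps)
  finally show ?thesis .
qed

lemma avg_continuous:
  assumes t: "0 \<le> t" and f: "\<And>y. \<bar>f y\<bar> \<le> B"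
  shows "\<bar>avg t f x - f x\<bar> \<le> 2 * q * t * B"
proof -
  have B: "0 \<le> B" using f[of 0] by linarith
  have "avg t f x - f x = measure_pmf.expectation (P t x) (\<lambda>y. f y - f x)"
    unfolding avg_def using f by (subst Bochner_Integration.integral_diff) (auto intro: integrable_pmf_bounded)
  also have "\<bar>\<dots>\<bar> \<le> measure_pmf.expectation (P t x) (\<lambda>y. \<bar>f y - f x\<bar>)"
    by (rule integral_abs_bound)
  also have "\<dots> \<le> measure_pmf.expectation (P t x) (\<lambda>y. 2 * B * (1 - indicator {x} y))"
  proof (intro integral_mono integrable_pmf_bounded[where B = "2 * B"])
    have le: "\<bar>f y - f x\<bar> \<le> 2 * B" for y
      using f[of x] f[of y] by linarith
    show "\<bar>\<bar>f y - f x\<bar>\<bar> \<le> 2 * B" for y using le by simp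
    show "\<bar>f y - f x\<bar> \<le> 2 * B * (1 - indicator {x} y)" for y
      using le by (auto simp: indicator_def)
  qed (use B in \<open>auto simp: indicator_def\<close>)
  also have "\<dots> = 2 * B * (1 - pmf (P t x) x)"
    by (simp add: integrable_pmf_bounded[where B = 1] measure_pmf_single)
  also have "\<dots> \<le> 2 * B * (t * q)"
    using B by (intro mult_left_mono exit_probability_le t) auto
  finally show ?thesis by (simp add: algebra_simps)
qed

text \<open>
  For bounded \<open>f\<close> the derivative may be taken inside the sum over all target states: only three of them
  have a nonzero rate, and the mass on the others is \<open>o(t)\<close>, because the rates in a row add up to \<open>0\<close>.
\<close>
lemma avg_derivative:
  assumes t: "0 \<le> t" and f: "\<And>y. \<bar>f y\<bar> \<le> B"
  shows "(\<lambda>n. real n * (avg (t / real n) f x - f x)) \<longlonglongrightarrow> t * killed_generator b d (\<lambda>_. 0) f x"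
proof -
  define S where "S = {x - 1, x, x + 1}"
  have S: "finite S" "x \<in> S" by (auto simp: S_def)
  define D where "D n y = real n * (pmf (P (t / real n) x) y - pmf (P 0 x) y)" for n y
  have D: "(\<lambda>n. D n y) \<longlonglongrightarrow> t * birth_death_rate b d x y" for y
    unfolding D_def by (rule right_derivative_sequence[OF P_deriv t])
  have sum_S: "(\<Sum>y\<in>S. g y * birth_death_rate b d x y) = killed_generator b d (\<lambda>_. 0) g x" for g
    using d_0 by (cases x) (auto simp: S_def birth_death_rate_def killed_generator_def algebra_simps)
  have remainder: "\<bar>real n * (avg (t / real n) f x - f x) - (\<Sum>y\<in>S. f y * D n y)\<bar>
      \<le> B * - (\<Sum>y\<in>S. D n y)" for n
  proof -
    define p where "p = P (t / real n) x"
    have ind: "(\<Sum>y\<in>S. g y * pmf (P 0 x) y) = g x" for g :: "nat \<Rightarrow> real"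
      using S by (simp add: P_0 pmf_return indicator_def if_distrib sum.delta cong: if_cong)
    have int: "measure_pmf.expectation p (\<lambda>y. f y * indicator S y) = (\<Sum>y\<in>S. f y * pmf p y)"
      using S by (subst integral_measure_pmf_real[of S]) (auto simp: indicator_def mult.commute)
    have "\<bar>measure_pmf.expectation p f - (\<Sum>y\<in>S. f y * pmf p y)\<bar>
       = \<bar>measure_pmf.expectation p (\<lambda>y. f y - f y * indicator S y)\<bar>"
      using f unfolding int[symmetric]
      by (subst Bochner_Integration.integral_diff) (auto intro!: integrable_pmf_bounded[where B = B] simp: indicator_def order_trans[OF _ f])
    also have "\<dots> \<le> measure_pmf.expectation p (\<lambda>y. \<bar>f y - f y * indicator S y\<bar>)"
      by (rule integral_abs_bound)
    also have "\<dots> \<le> measure_pmf.expectation p (\<lambda>y. B * (1 - indicator S y))"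
      using f order_trans[OF abs_ge_zero f]
      by (intro integral_mono integrable_pmf_bounded[where B = B]) (auto simp: indicator_def)
    also have "\<dots> = B * (1 - (\<Sum>y\<in>S. pmf p y))"
      using S by (simp add: integrable_pmf_bounded[where B = 1] measure_measure_pmf_finite)
    finally have "\<bar>real n\<bar> * \<bar>avg (t / real n) f x - (\<Sum>y\<in>S. f y * pmf p y)\<bar>
        \<le> \<bar>real n\<bar> * (B * (1 - (\<Sum>y\<in>S. pmf p y)))"
      by (intro mult_left_mono) (auto simp: avg_def p_def)
    moreover have "real n * (avg (t / real n) f x - f x) - (\<Sum>y\<in>S. f y * D n y)
       = real n * (avg (t / real n) f x - (\<Sum>y\<in>S. f y * pmf p y))"
    proof -
      have "(\<Sum>y\<in>S. f y * D n y) = real n * ((\<Sum>y\<in>S. f y * pmf p y) - (\<Sum>y\<in>S. f y * pmf (P 0 x) y))"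
        by (simp add: D_def p_def sum_distrib_left sum_subtractf[symmetric] algebra_simps)
      then show ?thesis unfolding ind by (simp add: algebra_simps)
    qed
    moreover have "- (\<Sum>y\<in>S. D n y) = real n * (1 - (\<Sum>y\<in>S. pmf p y))"
    proof -
      have "(\<Sum>y\<in>S. D n y) = real n * ((\<Sum>y\<in>S. pmf p y) - (\<Sum>y\<in>S. 1 * pmf (P 0 x) y))"
        by (simp add: D_def p_def sum_distrib_left sum_subtractf[symmetric] algebra_simps)
      then show ?thesis unfolding ind by (simp add: algebra_simps)
    qed
    ultimately show ?thesis
      by (simp add: abs_mult mult.left_commute)
  qed
  have "(\<lambda>n. B * - (\<Sum>y\<in>S. D n y)) \<longlonglongrightarrow> B * - (\<Sum>y\<in>S. t * birth_death_rate b d x y)"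
    by (intro tendsto_intros D)
  also have "(\<Sum>y\<in>S. t * birth_death_rate b d x y) = 0"
    using sum_S[of "\<lambda>_. 1"] by (simp add: sum_distrib_left[symmetric] killed_generator_def)
  finally have "(\<lambda>n. B * - (\<Sum>y\<in>S. D n y)) \<longlonglongrightarrow> 0" by simp
  then have "(\<lambda>n. real n * (avg (t / real n) f x - f x) - (\<Sum>y\<in>S. f y * D n y)) \<longlonglongrightarrow> 0"
    by (rule Lim_null_comparison[rotated])
      (use remainder in \<open>simp only: real_norm_def mult_zero_right minus_zero eventually_True\<close>)
  moreover have "(\<lambda>n. \<Sum>y\<in>S. f y * D n y) \<longlonglongrightarrow> (\<Sum>y\<in>S. f y * (t * birth_death_rate b d x y))"
    by (intro tendsto_intros D)
  moreover have "(\<Sum>y\<in>S. f y * (t * birth_death_rate b d x y)) = t * killed_generator b d (\<lambda>_. 0) f x"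
    unfolding sum_S[symmetric] by (simp add: sum_distrib_left algebra_simps)
  ultimately show ?thesis
    using tendsto_add by fastforce
qed

text \<open>
  Writing \<open>H\<close> for one step of length \<open>h\<close>, the error is the sum of \<open>(H\<^sup>k - I) (H - I) f\<close> over \<open>k < n\<close>,
  and each increment costs a factor of order \<open>h\<close> by continuity.
\<close>
lemma avg_iterated_increment:
  assumes h: "0 \<le> h" and f: "\<And>y. \<bar>f y\<bar> \<le> B"
  shows "\<bar>avg (real n * h) f x - f x - real n * (avg h f x - f x)\<bar> \<le> (2 * q * h)\<^sup>2 * B * (real n)\<^sup>2"
proof (induction n)
  case (Suc n)
  define D where "D y = avg h f y - f y" for y
  have D: "\<bar>D y\<bar> \<le> 2 * q * h * B" for y
    unfolding D_def by (rule avg_continuous[OF h f])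
  have "avg (real (Suc n) * h) f x = avg (real n * h) (avg h f) x"
    using avg_add_time[of "real n * h" h f B x] h f by (simp add: algebra_simps)
  then have "avg (real n * h) D x = avg (real (Suc n) * h) f x - avg (real n * h) f x"
    unfolding D_def using avg_diff[OF avg_bound[OF f] f] by simp
  then have eq: "avg (real (Suc n) * h) f x - f x - real (Suc n) * (avg h f x - f x)
     = (avg (real n * h) f x - f x - real n * (avg h f x - f x)) + (avg (real n * h) D x - D x)"
    by (simp add: D_def algebra_simps)
  have "\<bar>avg (real n * h) D x - D x\<bar> \<le> 2 * q * (real n * h) * (2 * q * h * B)"
    using h by (intro avg_continuous D) auto
  also have "\<dots> = (2 * q * h)\<^sup>2 * B * real n"
    by (simp add: power2_eq_square)
  finally have "\<bar>avg (real (Suc n) * h) f x - f x - real (Suc n) * (avg h f x - f x)\<bar>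
      \<le> (2 * q * h)\<^sup>2 * B * (real n)\<^sup>2 + (2 * q * h)\<^sup>2 * B * real n"
    unfolding eq using Suc by linarith
  also have "\<dots> = (2 * q * h)\<^sup>2 * B * ((real n)\<^sup>2 + real n)"
    by (simp add: algebra_simps)
  also have "\<dots> \<le> (2 * q * h)\<^sup>2 * B * (real (Suc n))\<^sup>2"
    using order_trans[OF abs_ge_zero f]
    by (intro mult_left_mono mult_nonneg_nonneg zero_le_power2)
      (simp_all add: power2_eq_square algebra_simps)
  finally show ?case .
qed (simp add: avg_0)

text \<open>
  The second order error bound, uniform in the state: apply the previous lemma with \<open>h = t / n\<close>,
  where its bound does not depend on \<open>n\<close>, and let \<open>n\<close> tend to infinity.
\<close>
lemma avg_first_order:
  assumes t: "0 \<le> t" and f: "\<And>y. \<bar>f y\<bar> \<le> B"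
  shows "\<bar>avg t f x - f x - t * killed_generator b d (\<lambda>_. 0) f x\<bar> \<le> (2 * q * t)\<^sup>2 * B"
proof -
  have "(\<lambda>n. \<bar>avg t f x - f x - real n * (avg (t / real n) f x - f x)\<bar>)
      \<longlonglongrightarrow> \<bar>avg t f x - f x - t * killed_generator b d (\<lambda>_. 0) f x\<bar>"
    by (rule tendsto_rabs[OF tendsto_diff[OF tendsto_const avg_derivative[OF t f]]])
  moreover have "\<bar>avg t f x - f x - real n * (avg (t / real n) f x - f x)\<bar> \<le> (2 * q * t)\<^sup>2 * B"
    if "1 \<le> n" for n
    using avg_iterated_increment[of "t / real n" f B n x] t f that
    by (simp add: power_mult_distrib power_divide)
  ultimately show ?thesis
    by (intro LIMSEQ_le_const2) auto
qed

end

section \<open>Euler steps and the comparison of iterates\<close>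

definition euler_step ::
    "(nat \<Rightarrow> real) \<Rightarrow> (nat \<Rightarrow> real) \<Rightarrow> (nat \<Rightarrow> real) \<Rightarrow> real \<Rightarrow> (nat \<Rightarrow> real) \<Rightarrow> nat \<Rightarrow> real" where
  "euler_step b d V h f x = f x + h * killed_generator b d V f x"

lemma euler_step_diff:
  "euler_step b d V h (\<lambda>y. f y - g y) x = euler_step b d V h f x - euler_step b d V h g x"
  by (simp add: euler_step_def killed_generator_def algebra_simps)

text \<open>
  The step is an average of \<open>f x\<close>, \<open>f (x + 1)\<close> and \<open>f (x - 1)\<close> with nonnegative weights of total
  at most \<open>1\<close>, provided that \<open>h\<close> is small compared to the rates.
\<close>
lemma euler_step_contraction:
  assumes nonneg: "0 \<le> b x" "0 \<le> d x" "0 \<le> V x" and h: "0 \<le> h" "h * (b x + d x + V x) \<le> 1"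
    and f: "\<And>y. \<bar>f y\<bar> \<le> B"
  shows "\<bar>euler_step b d V h f x\<bar> \<le> B"
proof -
  define c where "c = 1 - h * (b x + d x + V x)"
  have "euler_step b d V h f x = c * f x + h * b x * f (x + 1) + h * d x * f (x - 1)"
    by (simp add: c_def euler_step_def killed_generator_def algebra_simps)
  also have "\<bar>\<dots>\<bar> \<le> \<bar>c * f x\<bar> + \<bar>h * b x * f (x + 1)\<bar> + \<bar>h * d x * f (x - 1)\<bar>"
    by linarith
  also have "\<dots> = c * \<bar>f x\<bar> + h * b x * \<bar>f (x + 1)\<bar> + h * d x * \<bar>f (x - 1)\<bar>"
    using nonneg h by (simp add: abs_mult c_def)
  also have "\<dots> \<le> c * B + h * b x * B + h * d x * B"
    using nonneg h by (intro add_mono mult_left_mono f) (auto simp: c_def)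
  also have "\<dots> = B - h * V x * B"
    by (simp add: c_def algebra_simps)
  also have "\<dots> \<le> B"
    using nonneg h order_trans[OF abs_ge_zero f] by simp
  finally show ?thesis .
qed

text \<open>
  Replace \<open>S\<close> by \<open>T\<close> one factor at a time: each replacement costs \<open>e * B\<close>, and contractions do not
  amplify the errors already made.
\<close>
lemma iterates_close:
  fixes S T :: "('a \<Rightarrow> real) \<Rightarrow> 'a \<Rightarrow> real"
  assumes S: "\<And>f B x. (\<And>y. \<bar>f y\<bar> \<le> B) \<Longrightarrow> \<bar>S f x\<bar> \<le> B"
    and T: "\<And>f B x. (\<And>y. \<bar>f y\<bar> \<le> B) \<Longrightarrow> \<bar>T f x\<bar> \<le> B"
    and T_diff: "\<And>f g x. T (\<lambda>y. f y - g y) x = T f x - T g x"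
    and close: "\<And>f B x. (\<And>y. \<bar>f y\<bar> \<le> B) \<Longrightarrow> \<bar>S f x - T f x\<bar> \<le> e * B"
    and f: "\<And>y. \<bar>f y\<bar> \<le> B"
  shows "\<bar>(S ^^ n) f x - (T ^^ n) f x\<bar> \<le> real n * e * B"
proof (induction n arbitrary: x)
  case (Suc n)
  have bound: "\<bar>(S ^^ n) f y\<bar> \<le> B" for y
    by (induction n arbitrary: y) (auto intro: S f)
  have "\<bar>S ((S ^^ n) f) x - T ((S ^^ n) f) x\<bar> \<le> e * B"
    by (rule close[OF bound])
  moreover have "\<bar>T (\<lambda>y. (S ^^ n) f y - (T ^^ n) f y) x\<bar> \<le> real n * e * B"
    by (rule T[OF Suc])
  ultimately show ?case
    by (simp add: T_diff algebra_simps)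
qed simp

text \<open>
  With steps of length \<open>t / n\<close> there are \<open>n\<close> errors of order \<open>(t / n)\<^sup>2\<close>, which vanish in the limit.
  Only late \<open>T n\<close> have to be contractions, since an Euler step is one for short steps only.
\<close>
lemma iterates_close_LIMSEQ:
  fixes S T :: "nat \<Rightarrow> ('a \<Rightarrow> real) \<Rightarrow> 'a \<Rightarrow> real"
  assumes S: "\<And>n f B x. (\<And>y. \<bar>f y\<bar> \<le> B) \<Longrightarrow> \<bar>S n f x\<bar> \<le> B"
    and T: "\<And>n f B x. m \<le> n \<Longrightarrow> (\<And>y. \<bar>f y\<bar> \<le> B) \<Longrightarrow> \<bar>T n f x\<bar> \<le> B"
    and T_diff: "\<And>n f g x. T n (\<lambda>y. f y - g y) x = T n f x - T n g x"
    and close: "\<And>n f B x. (\<And>y. \<bar>f y\<bar> \<le> B) \<Longrightarrow> \<bar>S n f x - T n f x\<bar> \<le> C * (t / real n)\<^sup>2 * B"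
    and f: "\<And>y. \<bar>f y\<bar> \<le> B"
    and lim: "(\<lambda>n. (S n ^^ n) f x) \<longlonglongrightarrow> L"
  shows "(\<lambda>n. (T n ^^ n) f x) \<longlonglongrightarrow> L"
proof -
  have "\<bar>(S n ^^ n) f x - (T n ^^ n) f x\<bar> \<le> C * t\<^sup>2 * B / real n" if "max 1 m \<le> n" for n
  proof -
    have "\<bar>(S n ^^ n) f x - (T n ^^ n) f x\<bar> \<le> real n * (C * (t / real n)\<^sup>2) * B"
      using that by (intro iterates_close S T T_diff close f) auto
    also have "\<dots> = C * t\<^sup>2 * B / real n"
      using that by (simp add: power2_eq_square)
    finally show ?thesis .
  qed
  then have "(\<lambda>n. (S n ^^ n) f x - (T n ^^ n) f x) \<longlonglongrightarrow> 0"
    by (intro Lim_null_comparison[OF _ lim_const_over_n[of "C * t\<^sup>2 * B"]])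
      (auto simp: eventually_sequentially intro!: exI[of _ "max 1 m"])
  from tendsto_diff[OF lim this] show ?thesis by simp
qed

lemma exp_minus_linear_bound:
  fixes a :: real
  assumes "0 \<le> a"
  shows "\<bar>exp (- a) - 1 + a\<bar> \<le> a\<^sup>2"
proof -
  have "exp (- a) \<le> 1 / (1 + a)"
    using exp_ge_add_one_self[of a] assms by (simp add: exp_minus field_simps)
  also have "\<dots> \<le> 1 - a + a\<^sup>2"
    using assms by (simp add: field_simps power2_eq_square)
  finally show ?thesis
    using exp_ge_add_one_self[of "- a"] by simp
qed

text \<open>
  Moving for time \<open>h\<close> and then surviving with probability \<open>exp (- h * V y)\<close> agrees to first order
  with one Euler step for the killed generator.
\<close>
lemma (in bounded_semigroup) weighted_step_first_order:
  assumes h: "0 \<le> h" and V: "\<And>y. 0 \<le> V y" "\<And>y. V y \<le> v" and f: "\<And>y. \<bar>f y\<bar> \<le> B"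
  shows "\<bar>avg h (\<lambda>y. exp (- h * V y) * f y) x - euler_step b d V h f x\<bar> \<le> (2 * q + v)\<^sup>2 * h\<^sup>2 * B"
proof -
  have B: "0 \<le> B" using order_trans[OF abs_ge_zero f] .
  have v: "0 \<le> v" using order_trans[OF V] .
  \<comment> \<open>\<open>exp (- h * V y) * f y = f y - w y + r y\<close>, where \<open>w\<close> has order \<open>h\<close> and \<open>r\<close> has order \<open>h\<^sup>2\<close>.\<close>
  define w where "w y = h * V y * f y" for y
  define r where "r y = (exp (- h * V y) - 1 + h * V y) * f y" for y
  have w: "\<bar>w y\<bar> \<le> h * v * B" for y
    using h V v B by (auto simp: w_def abs_mult intro!: mult_mono f)
  have r: "\<bar>r y\<bar> \<le> (h * v)\<^sup>2 * B" for y
  proof -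
    have "\<bar>exp (- h * V y) - 1 + h * V y\<bar> \<le> (h * V y)\<^sup>2"
      using exp_minus_linear_bound[of "h * V y"] h V by simp
    also have "\<dots> \<le> (h * v)\<^sup>2"
      using h V v by (intro power_mono mult_left_mono) auto
    finally show ?thesis
      unfolding r_def abs_mult by (intro mult_mono f) auto
  qed
  have fw: "\<bar>f y - w y\<bar> \<le> B + h * v * B" for y
    using f[of y] w[of y] by linarith
  have "(\<lambda>y. exp (- h * V y) * f y) = (\<lambda>y. (f y - w y) - (- 1) * r y)"
    by (simp add: fun_eq_iff w_def r_def algebra_simps)
  then have "avg h (\<lambda>y. exp (- h * V y) * f y) x = avg h (\<lambda>y. f y - w y) x - avg h (\<lambda>y. (- 1) * r y) x"
    using avg_diff[of "\<lambda>y. f y - w y" _ "\<lambda>y. (- 1) * r y" "(h * v)\<^sup>2 * B" h x, OF fw] r by simp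
  also have "\<dots> = avg h f x - avg h w x + avg h r x"
    unfolding avg_cmult avg_diff[OF f w] by simp
  finally have "avg h (\<lambda>y. exp (- h * V y) * f y) x - euler_step b d V h f x
      = (avg h f x - f x - h * killed_generator b d (\<lambda>_. 0) f x) - (avg h w x - w x) + avg h r x"
    by (simp add: euler_step_def killed_generator_def w_def algebra_simps)
  also have "\<bar>\<dots>\<bar> \<le> (2 * q * h)\<^sup>2 * B + 2 * q * h * (h * v * B) + (h * v)\<^sup>2 * B"
  proof -
    have "\<bar>avg h f x - f x - h * killed_generator b d (\<lambda>_. 0) f x\<bar> \<le> (2 * q * h)\<^sup>2 * B"
      by (rule avg_first_order[OF h f])
    moreover have "\<bar>avg h w x - w x\<bar> \<le> 2 * q * h * (h * v * B)"
      by (rule avg_continuous[OF h w])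
    moreover have "\<bar>avg h r x\<bar> \<le> (h * v)\<^sup>2 * B"
      by (rule avg_bound[OF r])
    ultimately show ?thesis by linarith
  qed
  also have "\<dots> \<le> (2 * q + v)\<^sup>2 * h\<^sup>2 * B"
  proof -
    have "(2 * q + v)\<^sup>2 * h\<^sup>2 * B - ((2 * q * h)\<^sup>2 * B + 2 * q * h * (h * v * B) + (h * v)\<^sup>2 * B)
        = 2 * q * v * h\<^sup>2 * B"
      by (simp add: power2_eq_square algebra_simps)
    moreover have "0 \<le> 2 * q * v * h\<^sup>2 * B"
      using q_nonneg v B by simp
    ultimately show ?thesis by linarith
  qed
  finally show ?thesis .
qed

section \<open>The law of a process at equidistant times\<close>

text \<open>
  The values at times \<open>n * h, \<dots>, 2 * h, h\<close>, latest first, so that a new step is a \<open>Cons\<close>.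
  The starting point is left out; after \<open>n\<close> steps the current state is \<open>hd (history X h n \<omega> @ [x0])\<close>.
\<close>
primrec history :: "(real \<Rightarrow> 'a \<Rightarrow> nat) \<Rightarrow> real \<Rightarrow> nat \<Rightarrow> 'a \<Rightarrow> nat list" where
  "history X h 0 \<omega> = []"
| "history X h (Suc n) \<omega> = X (real (Suc n) * h) \<omega> # history X h n \<omega>"

primrec path_pmf :: "(nat \<Rightarrow> nat pmf) \<Rightarrow> nat \<Rightarrow> nat \<Rightarrow> nat list pmf" where
  "path_pmf K x 0 = return_pmf []"
| "path_pmf K x (Suc n) =
     bind_pmf (path_pmf K x n) (\<lambda>ys. map_pmf (\<lambda>y. y # ys) (K (hd (ys @ [x]))))"

lemma pmf_path_pmf_Suc:
  "pmf (path_pmf K x (Suc n)) zs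
    = (case zs of [] \<Rightarrow> 0 | y # ys \<Rightarrow> pmf (path_pmf K x n) ys * pmf (K (hd (ys @ [x]))) y)"
proof (cases zs)
  case Nil
  then have "zs \<notin> set_pmf (path_pmf K x (Suc n))" by auto
  then show ?thesis by (simp add: Nil set_pmf_iff del: path_pmf.simps)
next
  case (Cons y ys)
  have inner: "pmf (map_pmf (\<lambda>y. y # ws) (K (hd (ws @ [x])))) (y # ys)
      = indicator {ys} ws * pmf (K (hd (ys @ [x]))) y" for ws
  proof (cases "ws = ys")
    case True
    then show ?thesis
      using pmf_map_inj'[of "\<lambda>y. y # ys" "K (hd (ys @ [x]))" y] by (simp add: inj_def)
  next
    case False
    then have "y # ys \<notin> set_pmf (map_pmf (\<lambda>y. y # ws) (K (hd (ws @ [x]))))" by auto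
    then have "pmf (map_pmf (\<lambda>y. y # ws) (K (hd (ws @ [x])))) (y # ys) = 0"
      by (simp only: set_pmf_iff not_not)
    with False show ?thesis by simp
  qed
  show ?thesis
    by (simp add: Cons pmf_bind inner measure_pmf_single)
qed

lemma abs_prod_list_le_1:
  fixes \<phi> :: "'a \<Rightarrow> real"
  assumes "\<And>y. \<bar>\<phi> y\<bar> \<le> 1"
  shows "\<bar>prod_list (map \<phi> ys)\<bar> \<le> 1"
  by (induction ys) (auto simp: abs_mult assms intro!: mult_le_one)

text \<open>
  The weights \<open>\<phi>\<close> of all states visited are absorbed step by step from the last one backwards, which
  turns the expectation into an iterated one-step operator.
\<close>
lemma expectation_path_pmf:
  fixes \<phi> g :: "nat \<Rightarrow> real"
  assumes \<phi>: "\<And>y. \<bar>\<phi> y\<bar> \<le> 1" and g: "\<And>y. \<bar>g y\<bar> \<le> B"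
  shows "measure_pmf.expectation (path_pmf K x n) (\<lambda>ys. prod_list (map \<phi> ys) * g (hd (ys @ [x])))
    = ((\<lambda>f y. measure_pmf.expectation (K y) (\<lambda>z. \<phi> z * f z)) ^^ n) g x"
  using g
proof (induction n arbitrary: g)
  case (Suc n)
  define S where "S f y = measure_pmf.expectation (K y) (\<lambda>z. \<phi> z * f z)" for f y
  have weight: "\<bar>c * g y\<bar> \<le> B" if "\<bar>c\<bar> \<le> 1" for c y
    using mult_mono[OF that Suc.prems[of y]] by (simp add: abs_mult)
  have "\<bar>S g y\<bar> \<le> B" for y
    unfolding S_def by (intro abs_expectation_pmf_le weight \<phi>)
  then have IH: "measure_pmf.expectation (path_pmf K x n) (\<lambda>ys. prod_list (map \<phi> ys) * S g (hd (ys @ [x])))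
      = (S ^^ n) (S g) x"
    unfolding S_def by (rule Suc.IH)
  have "measure_pmf.expectation (path_pmf K x (Suc n)) (\<lambda>ys. prod_list (map \<phi> ys) * g (hd (ys @ [x])))
      = measure_pmf.expectation (path_pmf K x n) (\<lambda>ys. prod_list (map \<phi> ys) * S g (hd (ys @ [x])))"
    unfolding path_pmf.simps
    by (subst expectation_bind_pmf[where B = B])
      (auto simp: S_def mult_ac intro!: weight abs_prod_list_le_1 \<phi> simp flip: integral_mult_right_zero)
  then show ?case
    unfolding IH by (simp add: S_def[abs_def] funpow_Suc_right del: funpow.simps)
qed simp

context birth_death_process
begin

text \<open>
  Makes the events on which the Markov property is applied admissible.
\<close>
lemma history_in_filtration:
  assumes h: "0 \<le> h" and s: "real n * h \<le> s"
  shows "{\<omega> \<in> space M. history X h n \<omega> = ys} \<in> sets (natural_filtration M X s)"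
proof -
  define G where "G = {X r -` B \<inter> space M | r B. 0 \<le> r \<and> r \<le> s}"
  have sets: "sets (natural_filtration M X s) = sigma_sets (space M) G"
    unfolding natural_filtration_def G_def by (rule sets_measure_of) auto
  interpret sigma_algebra "space M" "sigma_sets (space M) G"
    by (rule sigma_algebra_sigma_sets) (auto simp: G_def)
  have "{\<omega> \<in> space M. history X h n \<omega> = ys} \<in> sigma_sets (space M) G"
    using s
  proof (induction n arbitrary: ys)
    case 0
    show ?case by (cases ys) auto
  next
    case (Suc n)
    show ?case
    proof (cases ys)
      case (Cons z zs)
      have "real n * h \<le> real (Suc n) * h" using h by (simp add: mult_right_mono)
      with Suc have IH: "{\<omega> \<in> space M. history X h n \<omega> = zs} \<in> sigma_sets (space M) G" by auto
      have "X (real (Suc n) * h) -` {z} \<inter> space M \<in> G"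
        unfolding G_def using Suc.prems h
        by (intro CollectI exI[of _ "real (Suc n) * h"] exI[of _ "{z}"]) simp
      then have "X (real (Suc n) * h) -` {z} \<inter> space M \<in> sigma_sets (space M) G"
        by (rule sigma_sets.Basic)
      from Int[OF this IH]
      have "(X (real (Suc n) * h) -` {z} \<inter> space M) \<inter> {\<omega> \<in> space M. history X h n \<omega> = zs}
          \<in> sigma_sets (space M) G" .
      also have "(X (real (Suc n) * h) -` {z} \<inter> space M) \<inter> {\<omega> \<in> space M. history X h n \<omega> = zs}
          = {\<omega> \<in> space M. history X h (Suc n) \<omega> = ys}"
        by (auto simp: Cons)
      finally show ?thesis .
    qed simp
  qed
  then show ?thesis unfolding sets .
qed

lemma history_measurable:
  assumes h: "0 \<le> h"
  shows "history X h n \<in> measurable M (count_space UNIV)"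
proof (induction n)
  case (Suc n)
  have [measurable]: "X (real (Suc n) * h) \<in> measurable M (count_space UNIV)"
    using h by (intro measurable_X) auto
  note Suc[measurable]
  have "(\<lambda>\<omega>. X (real (Suc n) * h) \<omega> # history X h n \<omega>) \<in> measurable M (count_space UNIV)"
    by measurable
  then show ?case by simp
qed simp

lemma prob_history:
  assumes h: "0 \<le> h" and P: "transition_semigroup (birth_death_rate b d) P" "markov_property M X P"
  shows "prob {\<omega> \<in> space M. history X h n \<omega> = ys} = pmf (path_pmf (P h) x0 n) ys"
proof (induction n arbitrary: ys)
  case 0
  show ?case by (cases ys) (simp_all add: prob_space)
next
  case (Suc n)
  show ?case
  proof (cases ys)
    case Nil
    then show ?thesis by (simp add: pmf_path_pmf_Suc del: path_pmf.simps)
  next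
    case (Cons z zs)
    define A where "A = {\<omega> \<in> space M. history X h n \<omega> = zs}"
    define x where "x = hd (zs @ [x0])"
    have A: "A \<in> sets (natural_filtration M X (real n * h))"
      unfolding A_def by (rule history_in_filtration[OF h]) simp
    have [measurable]: "A \<in> sets M"
      unfolding A_def using history_measurable[OF h, of n] by measurable
    have [measurable]: "X (real n * h) \<in> measurable M (count_space UNIV)"
      "X (real n * h + h) \<in> measurable M (count_space UNIV)"
      using h by (auto intro!: measurable_X)
    \<comment> \<open>The event \<open>A\<close> determines the present state, except that for \<open>n = 0\<close> it is known almost surely only.\<close>
    have current: "AE \<omega> in M. \<omega> \<in> A \<longrightarrow> X (real n * h) \<omega> = x"
    proof (cases n)
      case 0
      then show ?thesis using start by (auto simp: A_def x_def)
    qed (auto simp: A_def x_def)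
    have "prob {\<omega> \<in> space M. history X h (Suc n) \<omega> = ys} = prob {\<omega> \<in> A. X (real n * h + h) \<omega> = z}"
      by (rule arg_cong[where f = prob]) (auto simp: Cons A_def algebra_simps)
    also have "\<dots> = prob {\<omega> \<in> A. X (real n * h) \<omega> = x \<and> X (real n * h + h) \<omega> = z}"
      using current by (intro finite_measure_eq_AE) auto
    also have "\<dots> = prob {\<omega> \<in> A. X (real n * h) \<omega> = x} * pmf (P h x) z"
      using P(2) A h by (simp add: markov_property_def)
    also have "prob {\<omega> \<in> A. X (real n * h) \<omega> = x} = prob A"
      using current by (intro finite_measure_eq_AE) auto
    also have "prob A = pmf (path_pmf (P h) x0 n) zs"
      unfolding A_def by (rule Suc.IH)
    finally show ?thesis
      by (simp add: pmf_path_pmf_Suc Cons x_def del: path_pmf.simps)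
  qed
qed

text \<open>
  Both quantities of interest are limits of such expectations: survival with \<open>\<phi>\<close> the
  indicator of the states other than \<open>0\<close>, and exponential functionals with \<open>\<phi> y = exp (- h * V y)\<close>.
\<close>
lemma expectation_skeleton:
  fixes \<phi> g :: "nat \<Rightarrow> real"
  assumes h: "0 \<le> h" and P: "transition_semigroup (birth_death_rate b d) P" "markov_property M X P"
    and \<phi>: "\<And>y. \<bar>\<phi> y\<bar> \<le> 1" and g: "\<And>y. \<bar>g y\<bar> \<le> B"
  shows "expectation (\<lambda>\<omega>. (\<Prod>k<n. \<phi> (X (real (Suc k) * h) \<omega>)) * g (X (real n * h) \<omega>))
    = ((\<lambda>f y. measure_pmf.expectation (P h y) (\<lambda>z. \<phi> z * f z)) ^^ n) g x0"
proof -
  define W where "W ys = prod_list (map \<phi> ys) * g (hd (ys @ [x0]))" for ys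
  note [measurable] = history_measurable[OF h, of n]
  have [measurable]: "X (real k * h) \<in> measurable M (count_space UNIV)" for k
    using h by (auto intro!: measurable_X)
  have law: "distr M (count_space UNIV) (history X h n) = measure_pmf (path_pmf (P h) x0 n)"
  proof (rule measure_eqI_countable[where A = UNIV])
    fix ys
    have "emeasure (distr M (count_space UNIV) (history X h n)) {ys}
        = emeasure M {\<omega> \<in> space M. history X h n \<omega> = ys}"
      by (subst emeasure_distr) (auto intro!: arg_cong2[where f = emeasure])
    also have "\<dots> = ennreal (prob {\<omega> \<in> space M. history X h n \<omega> = ys})"
      by (rule emeasure_eq_measure)
    also have "\<dots> = emeasure (measure_pmf (path_pmf (P h) x0 n)) {ys}"
      by (simp add: prob_history[OF h P] emeasure_pmf_single)
    finally show "emeasure (distr M (count_space UNIV) (history X h n)) {ys}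
        = emeasure (measure_pmf (path_pmf (P h) x0 n)) {ys}" .
  qed auto
  have prod: "prod_list (map \<phi> (history X h m \<omega>)) = (\<Prod>k<m. \<phi> (X (real (Suc k) * h) \<omega>))" for \<omega> m
    by (induction m) (auto simp: mult.commute)
  have last: "AE \<omega> in M. X (real n * h) \<omega> = hd (history X h n \<omega> @ [x0])"
    using start by (cases n) auto
  have "expectation (\<lambda>\<omega>. (\<Prod>k<n. \<phi> (X (real (Suc k) * h) \<omega>)) * g (X (real n * h) \<omega>))
      = expectation (\<lambda>\<omega>. W (history X h n \<omega>))"
    using last by (intro integral_cong_AE) (auto simp: W_def prod simp del: of_nat_Suc)
  also have "\<dots> = measure_pmf.expectation (path_pmf (P h) x0 n) W"
    unfolding law[symmetric] by (subst integral_distr) auto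
  also have "\<dots> = ((\<lambda>f y. measure_pmf.expectation (P h y) (\<lambda>z. \<phi> z * f z)) ^^ n) g x0"
    unfolding W_def by (rule expectation_path_pmf[OF \<phi> g])
  finally show ?thesis .
qed

end

section \<open>Riemann sums of right continuous step functions\<close>

lemma sum_indicator_grid:
  fixes h :: real
  assumes "0 \<le> h"
  shows "(\<Sum>k<n. indicator {real k * h<..real (Suc k) * h} s) = (indicator {0<..real n * h} s :: real)"
proof (induction n)
  case (Suc n)
  have "0 \<le> real n * h" "real n * h \<le> real (Suc n) * h"
    using assms by (auto simp: algebra_simps)
  with Suc show ?case by (auto simp: indicator_def)
qed simp

lemma grid_point_ex:
  fixes h :: real
  assumes "0 \<le> h" "0 < s" "s \<le> real n * h"
  obtains k where "k < n" "real k * h < s" "s \<le> real (Suc k) * h"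
proof -
  have "(\<Sum>k<n. indicator {real k * h<..real (Suc k) * h} s) \<noteq> (0 :: real)"
    using assms by (simp add: sum_indicator_grid del: of_nat_Suc)
  then obtain k where "k < n" "indicator {real k * h<..real (Suc k) * h} s \<noteq> (0 :: real)"
    by (metis (no_types, lifting) sum.neutral lessThan_iff)
  then show ?thesis by (intro that[of k]) (auto simp: indicator_def simp del: of_nat_Suc split: if_splits)
qed

lemma eventually_mesh_less:
  fixes t e :: real
  assumes "0 < e"
  shows "eventually (\<lambda>n. t / real n < e) sequentially"
  using order_tendstoD(2)[OF lim_const_over_n[of t] assms] .

text \<open>
  Sampling at the right end points of the grid intervals is essential: for a fine grid the sample
  point belonging to \<open>s\<close> lies in the interval \<open>[s, s + e)\<close> on which \<open>f\<close> is constant, so that the step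
  functions converge pointwise.
\<close>
lemma right_riemann_sums:
  fixes f :: "real \<Rightarrow> real"
  assumes t: "0 \<le> t" and bound: "\<And>s. \<bar>f s\<bar> \<le> v"
    and right_constant: "\<And>s. 0 \<le> s \<Longrightarrow> \<exists>e>0. \<forall>r\<in>{s..<s + e}. f r = f s"
  shows "set_integrable lborel {0..t} f"
    and "(\<lambda>n. t / real n * (\<Sum>k<n. f (real (Suc k) * (t / real n)))) \<longlonglongrightarrow> (LBINT s:{0..t}. f s)"
proof -
  have v: "0 \<le> v" using order_trans[OF abs_ge_zero bound] .
  \<comment> \<open>The point \<open>0\<close>, a null set, lies in no grid interval and is removed.\<close>
  define F where "F s = indicator {0<..t} s * f s" for s
  define G where "G n s = (\<Sum>k<n. indicator {real k * (t / real n)<..real (Suc k) * (t / real n)} s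
      * f (real (Suc k) * (t / real n)))" for n s
  have [measurable]: "G n \<in> borel_measurable borel" for n
    unfolding G_def by measurable
  have grid: "(\<Sum>k<n. indicator {real k * (t / real n)<..real (Suc k) * (t / real n)} s)
      = (indicator {0<..t} s :: real)" if "1 \<le> n" for n s
    using sum_indicator_grid[of "t / real n" s n] t that by simp
  have lim: "(\<lambda>n. G n s) \<longlonglongrightarrow> F s" for s
  proof (cases "0 < s \<and> s \<le> t")
    case True
    then obtain e where e: "0 < e" "\<forall>r\<in>{s..<s + e}. f r = f s"
      using right_constant[OF less_imp_le, of s] by blast
    have "eventually (\<lambda>n. G n s = F s) sequentially"
      using eventually_mesh_less[OF e(1), of t] eventually_ge_at_top[of 1]
    proof eventually_elim
      case (elim n)
      have "G n s = (\<Sum>k<n. indicator {real k * (t / real n)<..real (Suc k) * (t / real n)} s * f s)"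
        unfolding G_def
      proof (rule sum.cong)
        fix k
        have "f (real (Suc k) * (t / real n)) = f s"
          if "s \<in> {real k * (t / real n)<..real (Suc k) * (t / real n)}"
          using that elim(1) by (intro e(2)[rule_format]) (auto simp: algebra_simps add_divide_distrib)
        then show "indicator {real k * (t / real n)<..real (Suc k) * (t / real n)} s
              * f (real (Suc k) * (t / real n))
            = indicator {real k * (t / real n)<..real (Suc k) * (t / real n)} s * f s"
          by (cases "s \<in> {real k * (t / real n)<..real (Suc k) * (t / real n)}") (auto simp del: of_nat_Suc)
      qed simp
      also have "\<dots> = F s"
        unfolding sum_distrib_right[symmetric] grid[OF elim(2)] F_def ..
      finally show ?case .
    qed
    then show ?thesis by (rule tendsto_eventually)
  next
    case False
    have "G n s = F s" if "1 \<le> n" for n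
    proof -
      have "(\<Sum>k<n. indicator {real k * (t / real n)<..real (Suc k) * (t / real n)} s) = (0 :: real)"
        using grid[OF that] False by simp
      then have "indicator {real k * (t / real n)<..real (Suc k) * (t / real n)} s = (0 :: real)"
        if "k < n" for k
        using that by (subst (asm) sum_nonneg_eq_0_iff) auto
      then have "G n s = 0" unfolding G_def by (intro sum.neutral) auto
      then show ?thesis using False by (auto simp: F_def)
    qed
    then show ?thesis
      by (intro tendsto_eventually) (auto simp: eventually_sequentially)
  qed
  have F_measurable[measurable]: "F \<in> borel_measurable borel"
    by (rule borel_measurable_LIMSEQ_real[OF lim]) measurable
  have dominating: "integrable lborel (\<lambda>s. v * indicator {0<..t} s)"
    using t by (intro integrable_mult_right) auto
  have G_bound: "\<bar>G n s\<bar> \<le> v * indicator {0<..t} s" if "1 \<le> n" for n s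
  proof -
    have "\<bar>G n s\<bar> \<le> (\<Sum>k<n. indicator {real k * (t / real n)<..real (Suc k) * (t / real n)} s * v)"
      unfolding G_def by (intro order_trans[OF sum_abs] sum_mono) (auto simp: abs_mult intro!: mult_left_mono bound)
    then show ?thesis unfolding sum_distrib_right[symmetric] grid[OF that] by (simp add: mult.commute)
  qed
  have F_integrable: "integrable lborel F"
    by (rule Bochner_Integration.integrable_bound[OF dominating])
      (use v bound in \<open>auto simp: F_def abs_mult indicator_def\<close>)
  have AE_F: "AE s in lborel. indicator {0..t} s *\<^sub>R f s = F s"
    using AE_lborel_singleton[of 0] by eventually_elim (auto simp: F_def indicator_def)
  have f_measurable: "(\<lambda>s. indicator {0..t} s *\<^sub>R f s) \<in> borel_measurable lborel"
  proof -
    have "(\<lambda>s. indicator {0..t} s *\<^sub>R f s) = (\<lambda>s. F s + indicator {0} s * f 0)"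
      using t by (auto simp: F_def indicator_def fun_eq_iff)
    then show ?thesis by simp
  qed
  show "set_integrable lborel {0..t} f"
    unfolding set_integrable_def
    by (subst integrable_cong_AE[OF f_measurable _ AE_F]) (auto simp: F_integrable)
  have eq: "(LBINT s:{0..t}. f s) = integral\<^sup>L lborel F"
    unfolding set_lebesgue_integral_def using AE_F f_measurable
    by (intro integral_cong_AE) auto
  have "(\<lambda>n. integral\<^sup>L lborel (G (Suc n))) \<longlonglongrightarrow> integral\<^sup>L lborel F"
    by (rule integral_dominated_convergence[OF _ _ dominating])
      (use G_bound lim[THEN LIMSEQ_Suc] in auto)
  moreover have "integral\<^sup>L lborel (G n) = t / real n * (\<Sum>k<n. f (real (Suc k) * (t / real n)))" for n
  proof -
    have piece: "(LINT s|lborel. indicator {a<..b} s * c) = (b - a) * c" if "a \<le> b" for a b c :: real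
      using that by simp
    have width: "real k * (t / real n) \<le> real (Suc k) * (t / real n)"
      "real (Suc k) * (t / real n) - real k * (t / real n) = t / real n" for k
      using t by (auto simp: algebra_simps add_divide_distrib)
    have "integral\<^sup>L lborel (G n) = (\<Sum>k<n. LINT s|lborel.
        indicator {real k * (t / real n)<..real (Suc k) * (t / real n)} s * f (real (Suc k) * (t / real n)))"
      unfolding G_def using width(1)
      by (intro Bochner_Integration.integral_sum) (simp del: of_nat_Suc)
    also have "\<dots> = (\<Sum>k<n. t / real n * f (real (Suc k) * (t / real n)))"
      by (simp only: piece[OF width(1)] width(2))
    finally have "integral\<^sup>L lborel (G n) = (\<Sum>k<n. t / real n * f (real (Suc k) * (t / real n)))" .
    then show ?thesis by (simp only: sum_distrib_left)
  qed
  ultimately show "(\<lambda>n. t / real n * (\<Sum>k<n. f (real (Suc k) * (t / real n)))) \<longlonglongrightarrow> (LBINT s:{0..t}. f s)"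
    unfolding eq by (subst filterlim_sequentially_Suc[symmetric]) (simp only:)
qed

section \<open>Feynman--Kac functionals and survival probabilities\<close>

context birth_death_process
begin

text \<open>
  Right continuity with values in a discrete space.
\<close>
lemma path_right_constant:
  assumes "\<omega> \<in> space M" "0 \<le> s"
  shows "\<exists>e>0. \<forall>r\<in>{s..<s + e}. X r \<omega> = X s \<omega>"
proof -
  have "eventually (\<lambda>r. X r \<omega> = X s \<omega>) (at_right s)"
    using right_continuous[OF assms] by (simp add: continuous_within tendsto_discrete)
  then obtain c where "s < c" "\<And>r. s < r \<Longrightarrow> r < c \<Longrightarrow> X r \<omega> = X s \<omega>"
    by (auto simp: eventually_at_right_field)
  then show ?thesis
    by (intro exI[of _ "c - s"]) (auto simp: le_less)
qed

lemma path_integral: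
  fixes V :: "nat \<Rightarrow> real"
  assumes "\<omega> \<in> space M" and t: "0 \<le> t" and V: "\<And>y. \<bar>V y\<bar> \<le> v"
  shows path_set_integrable: "set_integrable lborel {0..t} (\<lambda>s. V (X s \<omega>))"
    and path_riemann_sums: "(\<lambda>n. t / real n * (\<Sum>k<n. V (X (real (Suc k) * (t / real n)) \<omega>)))
      \<longlonglongrightarrow> (LBINT s:{0..t}. V (X s \<omega>))"
proof -
  have "\<exists>e>0. \<forall>r\<in>{s..<s + e}. V (X r \<omega>) = V (X s \<omega>)" if "0 \<le> s" for s
    using path_right_constant[OF assms(1) that] by metis
  from right_riemann_sums[OF t V this]
  show "set_integrable lborel {0..t} (\<lambda>s. V (X s \<omega>))"
    "(\<lambda>n. t / real n * (\<Sum>k<n. V (X (real (Suc k) * (t / real n)) \<omega>)))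
      \<longlonglongrightarrow> (LBINT s:{0..t}. V (X s \<omega>))"
    by blast+
qed

text \<open>
  The Feynman--Kac formula in discretised form: the right-hand side is the killed semigroup applied
  to \<open>g\<close>, and the left-hand side its Euler approximation.  Along a grid, the integral is a Riemann
  sum, the functional becomes a product of one-step weights, and the iterated weighted steps are
  compared with iterated Euler steps.
\<close>
theorem feynman_kac_limit:
  fixes V g :: "nat \<Rightarrow> real"
  assumes rates: "\<And>y. b y + d y \<le> q" and V: "\<And>y. 0 \<le> V y" "\<And>y. V y \<le> v"
    and g: "\<And>y. \<bar>g y\<bar> \<le> B" and t: "0 \<le> t"
  shows "(\<lambda>n. (euler_step b d V (t / real n) ^^ n) g x0)
    \<longlonglongrightarrow> expectation (\<lambda>\<omega>. g (X t \<omega>) * exp (- (LBINT s:{0..t}. V (X s \<omega>))))"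
proof -
  obtain P where P: "transition_semigroup (birth_death_rate b d) P" "markov_property M X P"
    using markov by blast
  have semigroup: "bounded_semigroup b d q P"
    by unfold_locales (use birth_nonneg death_nonneg death_0 rates P in auto)
  define S where "S n f x = bounded_semigroup.avg P (t / real n) (\<lambda>y. exp (- (t / real n) * V y) * f y) x" for n f x
  define m where "m = nat \<lceil>t * (q + v)\<rceil>"
  have weight_le_1: "exp (- (t / real n) * V y) \<le> 1" for n y
    using t V by simp
  show ?thesis
  proof (rule iterates_close_LIMSEQ[where S = S and C = "(2 * q + v)\<^sup>2" and t = t and m = "max 1 m" and f = g and B = B])
    show "\<bar>S n f x\<bar> \<le> B" if "\<And>y. \<bar>f y\<bar> \<le> B" for n f B x
      unfolding S_def
    proof (rule bounded_semigroup.avg_bound[OF semigroup])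
      show "\<bar>exp (- (t / real n) * V y) * f y\<bar> \<le> B" for y
        using mult_mono[of "exp (- (t / real n) * V y)" 1 "\<bar>f y\<bar>" B] weight_le_1 that by (simp add: abs_mult)
    qed
    show "\<bar>euler_step b d V (t / real n) f x\<bar> \<le> B"
      if n: "max 1 m \<le> n" and f: "\<And>y. \<bar>f y\<bar> \<le> B" for n f B x
    proof (rule euler_step_contraction[OF birth_nonneg death_nonneg V(1) _ _ f])
      have "t * (q + v) \<le> real n" using n unfolding m_def by linarith
      moreover have "t * (b x + d x + V x) \<le> t * (q + v)"
        using t rates[of x] V(2)[of x] by (intro mult_left_mono) auto
      ultimately show "t / real n * (b x + d x + V x) \<le> 1"
        using n by (simp add: field_simps)
    qed (use t in simp)
    show "\<bar>S n f x - euler_step b d V (t / real n) f x\<bar> \<le> (2 * q + v)\<^sup>2 * (t / real n)\<^sup>2 * B"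
      if "\<And>y. \<bar>f y\<bar> \<le> B" for n f B x
      unfolding S_def using t V that by (intro bounded_semigroup.weighted_step_first_order[OF semigroup]) auto
    have [measurable]: "X (real k * (t / real n)) \<in> measurable M (count_space UNIV)" for k n
      using t by (intro measurable_X) auto
    have [measurable]: "X t \<in> measurable M (count_space UNIV)"
      using t by (rule measurable_X)
    define A where "A n \<omega> = t / real n * (\<Sum>k<n. V (X (real (Suc k) * (t / real n)) \<omega>))" for n \<omega>
    have [measurable]: "A n \<in> borel_measurable M" for n
      unfolding A_def by measurable
    have A_lim: "(\<lambda>n. A n \<omega>) \<longlonglongrightarrow> (LBINT s:{0..t}. V (X s \<omega>))" if "\<omega> \<in> space M" for \<omega>
      unfolding A_def using V by (intro path_riemann_sums[OF that t, of V v]) simp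
    then have [measurable]: "(\<lambda>\<omega>. LBINT s:{0..t}. V (X s \<omega>)) \<in> borel_measurable M"
      by (rule borel_measurable_LIMSEQ_real) measurable
    have lim: "(\<lambda>n. expectation (\<lambda>\<omega>. g (X t \<omega>) * exp (- A n \<omega>)))
        \<longlonglongrightarrow> expectation (\<lambda>\<omega>. g (X t \<omega>) * exp (- (LBINT s:{0..t}. V (X s \<omega>))))"
    proof (rule integral_dominated_convergence[where w = "\<lambda>_. B"])
      show "AE \<omega> in M. (\<lambda>n. g (X t \<omega>) * exp (- A n \<omega>))
          \<longlonglongrightarrow> g (X t \<omega>) * exp (- (LBINT s:{0..t}. V (X s \<omega>)))"
        by (intro AE_I2 tendsto_intros A_lim)
      show "AE \<omega> in M. norm (g (X t \<omega>) * exp (- A n \<omega>)) \<le> B" for n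
      proof (intro AE_I2)
        fix \<omega>
        have "0 \<le> A n \<omega>" unfolding A_def using t V by (intro mult_nonneg_nonneg sum_nonneg) auto
        then show "norm (g (X t \<omega>) * exp (- A n \<omega>)) \<le> B"
          using mult_mono[OF g[of "X t \<omega>"], of "exp (- A n \<omega>)" 1] order_trans[OF abs_ge_zero g]
          by (simp add: abs_mult)
      qed
    qed auto
    have eq: "expectation (\<lambda>\<omega>. g (X t \<omega>) * exp (- A n \<omega>)) = (S n ^^ n) g x0" if n: "1 \<le> n" for n
    proof -
      have "g (X t \<omega>) * exp (- A n \<omega>)
          = (\<Prod>k<n. exp (- (t / real n) * V (X (real (Suc k) * (t / real n)) \<omega>)))
            * g (X (real n * (t / real n)) \<omega>)" for \<omega>
        using n by (simp add: A_def exp_sum[symmetric] sum_negf sum_distrib_left del: of_nat_Suc)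
      then have "expectation (\<lambda>\<omega>. g (X t \<omega>) * exp (- A n \<omega>))
          = expectation (\<lambda>\<omega>. (\<Prod>k<n. exp (- (t / real n) * V (X (real (Suc k) * (t / real n)) \<omega>)))
            * g (X (real n * (t / real n)) \<omega>))"
        by presburger
      also have "\<dots> = (S n ^^ n) g x0"
        unfolding S_def[abs_def] bounded_semigroup.avg_def[OF semigroup]
        by (intro expectation_skeleton[OF _ P _ g]) (use t weight_le_1 in auto)
      finally show ?thesis .
    qed
    show "(\<lambda>n. (S n ^^ n) g x0)
        \<longlonglongrightarrow> expectation (\<lambda>\<omega>. g (X t \<omega>) * exp (- (LBINT s:{0..t}. V (X s \<omega>))))"
      using lim by (rule Lim_transform_eventually)
        (use eq in \<open>auto simp: eventually_sequentially intro!: exI[of _ 1]\<close>)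
  qed (auto simp: euler_step_diff g)
qed

text \<open>
  The hitting time is an infimum over an open-ended set of times; by right continuity a path that
  is nonzero at \<open>t\<close> stays so for a while, and a path that is at \<open>0\<close> at time \<open>t\<close> is also there at
  positive times arbitrarily close to \<open>t\<close>, which matters for \<open>t = 0\<close>.
\<close>
lemma hitting_time_0_gt_iff:
  assumes \<omega>: "\<omega> \<in> space M" and t: "0 \<le> t"
  shows "ereal t < hitting_time_0 X \<omega> \<longleftrightarrow> X t \<omega> \<noteq> 0 \<and> (\<forall>s. 0 < s \<and> s < t \<longrightarrow> X s \<omega> \<noteq> 0)"
proof -
  obtain e where e: "0 < e" "\<forall>r\<in>{t..<t + e}. X r \<omega> = X t \<omega>"
    using path_right_constant[OF \<omega> t] by blast
  have upper: "hitting_time_0 X \<omega> \<le> ereal s" if "0 < s" "X s \<omega> = 0" for s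
    unfolding hitting_time_0_def using that by (intro Inf_lower) auto
  show ?thesis
  proof (intro iffI conjI allI impI)
    assume less: "ereal t < hitting_time_0 X \<omega>"
    show "X s \<omega> \<noteq> 0" if "0 < s \<and> s < t" for s
      using upper[of s] less that by (auto dest: less_le_trans)
    obtain z where z: "t < z" "ereal z < hitting_time_0 X \<omega>"
      using ereal_dense2[OF less] by auto
    define r where "r = min z (t + e / 2)"
    have r: "0 < r" "t \<le> r" "r < t + e" "r \<le> z"
      using z e t by (auto simp: r_def min_def)
    show "X t \<omega> \<noteq> 0"
    proof
      assume "X t \<omega> = 0"
      then have "X r \<omega> = 0" using r e(2)[rule_format, of r] by simp
      then have "hitting_time_0 X \<omega> \<le> ereal r" by (rule upper[OF r(1)])
      also have "\<dots> \<le> ereal z" using r by simp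
      finally show False using z by simp
    qed
  next
    assume nonzero: "X t \<omega> \<noteq> 0 \<and> (\<forall>s. 0 < s \<and> s < t \<longrightarrow> X s \<omega> \<noteq> 0)"
    have "t + e \<le> s" if "0 < s" "X s \<omega> = 0" for s
    proof (rule ccontr)
      assume "\<not> t + e \<le> s"
      then show False using nonzero e(2)[rule_format, of s] that by (cases "s < t") auto
    qed
    then have "ereal (t + e) \<le> hitting_time_0 X \<omega>"
      unfolding hitting_time_0_def by (intro Inf_greatest) auto
    then show "ereal t < hitting_time_0 X \<omega>"
      using e by (auto intro: less_le_trans[of _ "ereal (t + e)"])
  qed
qed

text \<open>
  A visit to \<open>0\<close> lasts for a positive time, hence is detected by every sufficiently fine grid.
\<close>
lemma survival_indicator_LIMSEQ:
  assumes \<omega>: "\<omega> \<in> space M" and t: "0 \<le> t"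
  shows "(\<lambda>n. \<Prod>k<n. indicator (- {0}) (X (real (Suc k) * (t / real n)) \<omega>) :: real)
    \<longlonglongrightarrow> indicator {\<omega> \<in> space M. ereal t < hitting_time_0 X \<omega>} \<omega>"
proof (cases "ereal t < hitting_time_0 X \<omega>")
  case True
  have "X (real (Suc k) * (t / real n)) \<omega> \<noteq> 0" if "k < n" for k n
  proof -
    define s where "s = real (Suc k) * (t / real n)"
    have "s \<le> real n * (t / real n)"
      unfolding s_def using that t by (intro mult_right_mono) auto
    then have "s \<le> t" "0 \<le> s" "s = 0 \<longrightarrow> t = 0" using that t by (auto simp: s_def)
    then show ?thesis
      using True unfolding hitting_time_0_gt_iff[OF \<omega> t] s_def[symmetric]
      by (cases "s = t") (auto simp: le_less)
  qed
  then have "(\<Prod>k<n. indicator (- {0}) (X (real (Suc k) * (t / real n)) \<omega>)) = (1 :: real)" for n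
    by (intro prod.neutral) auto
  then show ?thesis using True \<omega> by simp
next
  case False
  then obtain s where s: "X s \<omega> = 0" "s = t \<or> 0 < s \<and> s < t"
    unfolding hitting_time_0_gt_iff[OF \<omega> t] by blast
  then have s_pos: "0 \<le> s" using t by auto
  obtain e where e: "0 < e" "\<forall>r\<in>{s..<s + e}. X r \<omega> = X s \<omega>"
    using path_right_constant[OF \<omega> s_pos] by blast
  have "eventually (\<lambda>n. (\<Prod>k<n. indicator (- {0}) (X (real (Suc k) * (t / real n)) \<omega>)) = (0 :: real)) sequentially"
    using eventually_mesh_less[OF e(1), of t] eventually_ge_at_top[of 1]
  proof eventually_elim
    case (elim n)
    have "\<exists>k<n. X (real (Suc k) * (t / real n)) \<omega> = 0"
      using s(2)
    proof
      assume "s = t"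
      then show ?thesis using s(1) elim by (intro exI[of _ "n - 1"]) auto
    next
      assume "0 < s \<and> s < t"
      with t elim obtain k where k: "k < n" "real k * (t / real n) < s" "s \<le> real (Suc k) * (t / real n)"
        using grid_point_ex[of "t / real n" s n] by auto
      have "real (Suc k) * (t / real n) = real k * (t / real n) + t / real n"
        by (simp add: algebra_simps add_divide_distrib)
      with k(2) elim(1) have "real (Suc k) * (t / real n) < s + e" by linarith
      with e(2)[rule_format, of "real (Suc k) * (t / real n)"] k(3) s(1)
      have "X (real (Suc k) * (t / real n)) \<omega> = 0" by (simp del: of_nat_Suc)
      with k(1) show ?thesis by blast
    qed
    then obtain k where "k < n" "X (real (Suc k) * (t / real n)) \<omega> = 0" by blast
    then show ?case by (intro prod_zero bexI[of _ k]) auto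
  qed
  then show ?thesis using False by (simp add: tendsto_eventually)
qed

text \<open>
  Survival until time \<open>t\<close> of the process started at \<open>x + 1\<close>.  Relabelling the states \<open>1, 2, \<dots>\<close> as
  \<open>0, 1, \<dots>\<close> turns absorption in \<open>0\<close> into killing of the relabelled process in its lowest state, at
  the rate \<open>d 1\<close> of the forbidden jump.
\<close>
theorem survival_limit:
  assumes rates: "\<And>y. b y + d y \<le> q" and x0: "x0 = x + 1" and t: "0 \<le> t"
  shows "(\<lambda>n. (euler_step (\<lambda>y. b (y + 1)) (\<lambda>y. if y = 0 then 0 else d (y + 1))
        (\<lambda>y. if y = 0 then d 1 else 0) (t / real n) ^^ n) (\<lambda>_. 1) x)
    \<longlonglongrightarrow> prob {\<omega> \<in> space M. ereal t < hitting_time_0 X \<omega>}"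
    (is "(\<lambda>n. (?T n ^^ n) _ _) \<longlonglongrightarrow> _")
proof -
  obtain P where P: "transition_semigroup (birth_death_rate b d) P" "markov_property M X P"
    using markov by blast
  have semigroup: "bounded_semigroup b d q P"
    by unfold_locales (use birth_nonneg death_nonneg death_0 rates P in auto)
  \<comment> \<open>\<open>ext f\<close> is \<open>f\<close> on the original states, with value \<open>0\<close> in the absorbing state.  \<open>R n\<close> acts on
    functions of the original states and \<open>S n\<close> on functions of the relabelled states.\<close>
  define ext where "ext f y = (case y of 0 \<Rightarrow> 0 | Suc z \<Rightarrow> f z)" for f :: "nat \<Rightarrow> real" and y
  define S where "S n f y = bounded_semigroup.avg P (t / real n) (ext f) (y + 1)" for n f y
  define R where "R n f y = bounded_semigroup.avg P (t / real n) (\<lambda>z. indicator (- {0}) z * f z) y" for n f y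
  have ext_bound: "\<bar>ext f y\<bar> \<le> B" if "\<And>z. \<bar>f z\<bar> \<le> B" for f B y
    using that order_trans[OF abs_ge_zero that] by (auto simp: ext_def split: nat.split)
  have R_S: "(R n ^^ k) f (y + 1) = (S n ^^ k) (\<lambda>z. f (z + 1)) y" for n k f y
  proof (induction k arbitrary: y)
    case (Suc k)
    have "(\<lambda>z. indicator (- {0}) z * (R n ^^ k) f z) = ext ((S n ^^ k) (\<lambda>z. f (z + 1)))"
      using Suc by (auto simp: ext_def fun_eq_iff split: nat.split)
    then show ?case
      by (simp add: R_def[of n "(R n ^^ k) f"] S_def[of n "(S n ^^ k) (\<lambda>z. f (Suc z))"])
  qed simp
  define m where "m = nat \<lceil>t * q\<rceil>"
  show ?thesis
  proof (rule iterates_close_LIMSEQ[where S = S and C = "4 * q\<^sup>2" and t = t and m = "max 1 m"])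
    show "\<bar>S n f y\<bar> \<le> B" if "\<And>y. \<bar>f y\<bar> \<le> B" for n f B y
      unfolding S_def by (intro bounded_semigroup.avg_bound[OF semigroup] ext_bound that)
    show "\<bar>?T n f y\<bar> \<le> B" if n: "max 1 m \<le> n" and f: "\<And>y. \<bar>f y\<bar> \<le> B" for n f B y
    proof (rule euler_step_contraction[OF _ _ _ _ _ f])
      have "t * q \<le> real n" using n unfolding m_def by linarith
      moreover have "t * (b (y + 1) + d (y + 1)) \<le> t * q"
        using t by (intro mult_left_mono rates)
      ultimately have "t / real n * (b (y + 1) + d (y + 1)) \<le> 1"
        using n by (simp add: field_simps)
      then show "t / real n * (b (y + 1) + (if y = 0 then 0 else d (y + 1)) + (if y = 0 then d 1 else 0)) \<le> 1"
        by (cases "y = 0") simp_all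
    qed (use t birth_nonneg death_nonneg in auto)
    show "\<bar>S n f y - ?T n f y\<bar> \<le> 4 * q\<^sup>2 * (t / real n)\<^sup>2 * B" if f: "\<And>y. \<bar>f y\<bar> \<le> B" for n f B y
    proof -
      have "?T n f y = ext f (y + 1) + t / real n * killed_generator b d (\<lambda>_. 0) (ext f) (y + 1)"
        by (cases y) (auto simp: ext_def euler_step_def killed_generator_def)
      moreover have "\<bar>bounded_semigroup.avg P (t / real n) (ext f) (y + 1) - ext f (y + 1)
          - t / real n * killed_generator b d (\<lambda>_. 0) (ext f) (y + 1)\<bar> \<le> (2 * q * (t / real n))\<^sup>2 * B"
        using t f by (intro bounded_semigroup.avg_first_order[OF semigroup] ext_bound) auto
      ultimately show ?thesis
        unfolding S_def by (simp only: power_mult_distrib) (simp add: algebra_simps)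
    qed
    have X_measurable: "X (real k * (t / real n)) \<in> measurable M (count_space UNIV)" for k n
      using t by (intro measurable_X) auto
    define A where "A n \<omega> = (\<Prod>k<n. indicator (- {0}) (X (real (Suc k) * (t / real n)) \<omega>) :: real)" for n \<omega>
    have [measurable]: "A n \<in> borel_measurable M" for n
      unfolding A_def
      by (rule borel_measurable_prod) (rule measurable_compose[OF X_measurable], simp)
    have A_lim: "(\<lambda>n. A n \<omega>) \<longlonglongrightarrow> indicator {\<omega> \<in> space M. ereal t < hitting_time_0 X \<omega>} \<omega>"
      if "\<omega> \<in> space M" for \<omega>
      unfolding A_def by (rule survival_indicator_LIMSEQ[OF that t])
    have ind[measurable]: "(indicator {\<omega> \<in> space M. ereal t < hitting_time_0 X \<omega>} :: 'a \<Rightarrow> real) \<in> borel_measurable M"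
      by (rule borel_measurable_LIMSEQ_real[where u = A]) (auto intro: A_lim)
    have [measurable]: "{\<omega> \<in> space M. ereal t < hitting_time_0 X \<omega>} \<in> sets M"
      using ind unfolding borel_measurable_indicator_iff by (subst (asm) Int_absorb2) auto
    have "(\<lambda>n. expectation (A n)) \<longlonglongrightarrow> expectation (indicator {\<omega> \<in> space M. ereal t < hitting_time_0 X \<omega>})"
    proof (rule integral_dominated_convergence[where w = "\<lambda>_. 1"])
      have "\<bar>A n \<omega>\<bar> \<le> 1" for n \<omega>
        unfolding A_def abs_prod by (intro prod_le_1) (auto simp: indicator_def)
      then show "AE \<omega> in M. norm (A n \<omega>) \<le> 1" for n by simp
    qed (use A_lim in auto)
    moreover have "expectation (A n) = (S n ^^ n) (\<lambda>_. 1) x" for n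
    proof -
      have "expectation (A n) = expectation (\<lambda>\<omega>. A n \<omega> * (\<lambda>_. 1) (X (real n * (t / real n)) \<omega>))"
        by simp
      also have "\<dots> = (R n ^^ n) (\<lambda>_. 1) x0"
        unfolding R_def[abs_def] bounded_semigroup.avg_def[OF semigroup] A_def
        by (intro expectation_skeleton[OF _ P, where B = 1]) (use t in \<open>auto simp: indicator_def\<close>)
      finally show ?thesis by (simp only: x0 R_S)
    qed
    ultimately show "(\<lambda>n. (S n ^^ n) (\<lambda>_. 1) x) \<longlonglongrightarrow> prob {\<omega> \<in> space M. ereal t < hitting_time_0 X \<omega>}"
      by simp
  qed (auto simp: euler_step_diff)
qed

end

section \<open>Intertwining, and the survival probability of the M/M/1 process\<close>

text \<open>
  Both killed generators combine \<open>f (x + 1)\<close>, \<open>f (x - 1)\<close> and \<open>f x\<close> with constant coefficients, where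
  the jump down from \<open>0\<close> is replaced by killing, that is, \<open>f (-1) = 0\<close>.  Conjugation with \<open>u\<close>
  makes the two off-diagonal coefficients equal to \<open>r\<close>.  The diagonal stays \<open>-(lam + nu)\<close>, and what
  exceeds the jump rate \<open>2 * r\<close> of the symmetric walk appears as a constant killing rate.
\<close>
lemma euler_step_intertwining:
  fixes u :: "nat \<Rightarrow> real"
  assumes up: "\<And>y. lam * u (y + 1) = r * u y" and down: "\<And>y. nu * u y = r * u (y + 1)"
  shows "euler_step (\<lambda>_. lam) (\<lambda>y. if y = 0 then 0 else nu) (\<lambda>y. if y = 0 then nu else 0) h (\<lambda>y. u y * f y) x
    = u x * euler_step (\<lambda>_. r) (\<lambda>y. if y = 0 then 0 else r) (\<lambda>y. lam + nu - 2 * r + r * indicator {0} y) h f x"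
proof (cases x)
  case 0
  then show ?thesis
    using up[of 0] by (simp add: euler_step_def killed_generator_def algebra_simps)
next
  case (Suc z)
  have "lam * (u (Suc x) * f (Suc x)) = u x * (r * f (Suc x))" "nu * (u z * f z) = u x * (r * f z)"
    using arg_cong[OF up[of x], of "\<lambda>a. a * f (Suc x)"] arg_cong[OF down[of z], of "\<lambda>a. a * f z"]
    by (simp_all add: Suc mult_ac)
  note * = this[unfolded Suc]
  show ?thesis
    by (simp add: Suc euler_step_def killed_generator_def *) (simp add: algebra_simps)
qed

text \<open>
  Up to the factor \<open>u x\<close> both sides are limits of the same Euler iterates.  The constant part of the
  killing rate leaves the expectation as the exponential factor.
\<close>
lemma mm1_survival_probability:
  fixes lam nu t :: real and x :: nat and u :: "nat \<Rightarrow> real"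
    and M :: "'a measure" and X :: "real \<Rightarrow> 'a \<Rightarrow> nat"
    and N :: "'b measure" and Xu :: "real \<Rightarrow> 'b \<Rightarrow> nat"
  assumes lam_pos: "0 < lam" and lam_less_nu: "lam < nu"
    and u_def: "\<And>y. u y = (nu / lam) powr (real y / 2)"
    and X: "birth_death_process M (mm1_birth lam) (mm1_death nu) (x + 1) X"
    and Xu: "birth_death_process N
               (modified_birth u (mm1_birth lam)) (modified_death u (mm1_death nu)) x Xu"
    and t: "0 \<le> t"
  shows "measure M {\<omega> \<in> space M. hitting_time_0 X \<omega> > ereal t} =
    u x * exp (- t * (sqrt lam - sqrt nu)\<^sup>2) * (\<integral>\<omega>. 1 / u (Xu t \<omega>) *
        exp (- sqrt (lam * nu) * (LBINT s:{0..t}. indicator {0} (Xu s \<omega>))) \<partial>N)"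
proof -
  define r where "r = sqrt (lam * nu)"
  define c where "c = (sqrt lam - sqrt nu)\<^sup>2"
  have r: "0 < r" using lam_pos lam_less_nu by (simp add: r_def)
  have c: "c = lam + nu - 2 * r" "0 \<le> c"
    using lam_pos lam_less_nu
    by (simp add: c_def r_def power2_diff real_sqrt_mult) (simp add: c_def)
  have u_ge_1: "1 \<le> u y" for y
    using lam_pos lam_less_nu by (simp add: u_def ge_one_powr_ge_zero)
  have u_pos: "0 < u y" for y using u_ge_1[of y] by linarith
  have u_Suc: "u (y + 1) = u y * sqrt (nu / lam)" for y
    using lam_pos lam_less_nu
    by (simp add: u_def powr_half_sqrt[symmetric] powr_add[symmetric] add_divide_distrib add.commute)
  have up: "lam * u (y + 1) = r * u y" and down: "nu * u y = r * u (y + 1)" for y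
  proof -
    have "lam * sqrt (nu / lam) = (lam / sqrt lam) * sqrt nu" "r * sqrt (nu / lam) = sqrt nu * sqrt nu"
      using lam_pos by (simp_all add: r_def real_sqrt_mult real_sqrt_divide)
    then have "lam * sqrt (nu / lam) = r" "r * sqrt (nu / lam) = nu"
      using lam_pos lam_less_nu by (simp_all only: real_div_sqrt r_def real_sqrt_mult) simp_all
    then show "lam * u (y + 1) = r * u y" "nu * u y = r * u (y + 1)"
      unfolding u_Suc by (simp_all add: mult.left_commute mult.commute)
  qed

  \<comment> \<open>Both modified rates equal the geometric mean of \<open>lam\<close> and \<open>nu\<close>: the modification is the
    symmetric walk reflected at \<open>0\<close>.\<close>
  have birth_r: "modified_birth u (mm1_birth lam) = (\<lambda>_. r)"
    using up u_pos by (simp add: modified_birth_def mm1_birth_def fun_eq_iff field_simps)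
      (metis mult.commute less_irrefl)
  have death_r: "modified_death u (mm1_death nu) = (\<lambda>y. if y = 0 then 0 else r)"
  proof
    fix y
    show "modified_death u (mm1_death nu) y = (if y = 0 then 0 else r)"
      using down[of "y - 1"] u_pos[of y]
      by (cases y) (simp_all add: modified_death_def mm1_death_def field_simps)
  qed
  have walk: "birth_death_process N (\<lambda>_. r) (\<lambda>y. if y = 0 then 0 else r) x Xu"
    using Xu unfolding birth_r death_r .

  let ?T = "euler_step (\<lambda>_. lam) (\<lambda>y. if y = 0 then 0 else nu) (\<lambda>y. if y = 0 then nu else 0)"
  let ?V = "\<lambda>y. c + r * indicator {0} y :: real"
  let ?W = "euler_step (\<lambda>_. r) (\<lambda>y. if y = 0 then 0 else r) ?V"
  let ?I = "\<lambda>\<omega>. LBINT s:{0..t}. indicator {0} (Xu s \<omega>) :: real"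
  let ?E = "\<integral>\<omega>. 1 / u (Xu t \<omega>) * exp (- r * ?I \<omega>) \<partial>N"
  have conj: "(?T h ^^ n) (\<lambda>y. u y * f y) = (\<lambda>y. u y * (?W h ^^ n) f y)" for h n f
  proof (induction n)
    case (Suc n)
    show ?case
      by (simp add: Suc) (simp add: fun_eq_iff euler_step_intertwining[of lam u r nu, OF up down] c)
  qed simp

  have "(\<lambda>n. (?T (t / real n) ^^ n) (\<lambda>_. 1) x) \<longlonglongrightarrow> measure M {\<omega> \<in> space M. ereal t < hitting_time_0 X \<omega>}"
    using birth_death_process.survival_limit[OF X, of "lam + nu" x t] t lam_pos lam_less_nu
    by (simp add: mm1_birth_def mm1_death_def indicator_def cong: if_cong)
  moreover have "(\<lambda>n. (?T (t / real n) ^^ n) (\<lambda>_. 1) x)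
      \<longlonglongrightarrow> u x * (\<integral>\<omega>. 1 / u (Xu t \<omega>) * exp (- (LBINT s:{0..t}. ?V (Xu s \<omega>))) \<partial>N)"
  proof -
    \<comment> \<open>Feynman--Kac needs a bounded function; this is why the factor \<open>u\<close> stays outside and the
      bounded \<open>1 / u\<close> is the function inside.\<close>
    have "(\<lambda>_. 1) = (\<lambda>y. u y * (1 / u y))" using u_pos by (simp add: less_imp_neq[symmetric])
    then have "(?T h ^^ n) (\<lambda>_. 1) x = u x * (?W h ^^ n) (\<lambda>y. 1 / u y) x" for h n
      using conj[of _ _ "\<lambda>y. 1 / u y"] by simp
    moreover have "(\<lambda>n. (?W (t / real n) ^^ n) (\<lambda>y. 1 / u y) x)
        \<longlonglongrightarrow> (\<integral>\<omega>. 1 / u (Xu t \<omega>) * exp (- (LBINT s:{0..t}. ?V (Xu s \<omega>))) \<partial>N)"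
      using r c u_ge_1 u_pos t
      by (intro birth_death_process.feynman_kac_limit[OF walk, where q = "2 * r" and v = "c + r" and B = 1])
        (auto simp: indicator_def abs_of_pos)
    ultimately show ?thesis by (simp only: tendsto_mult_left)
  qed
  ultimately have "measure M {\<omega> \<in> space M. ereal t < hitting_time_0 X \<omega>}
      = u x * (\<integral>\<omega>. 1 / u (Xu t \<omega>) * exp (- (LBINT s:{0..t}. ?V (Xu s \<omega>))) \<partial>N)"
    by (rule LIMSEQ_unique)
  also have "(\<integral>\<omega>. 1 / u (Xu t \<omega>) * exp (- (LBINT s:{0..t}. ?V (Xu s \<omega>))) \<partial>N)
      = (\<integral>\<omega>. exp (- t * c) * (1 / u (Xu t \<omega>) * exp (- r * ?I \<omega>)) \<partial>N)"
  proof (rule Bochner_Integration.integral_cong)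
    fix \<omega> assume \<omega>: "\<omega> \<in> space N"
    have int: "set_integrable lborel {0..t} (\<lambda>s. indicator {0} (Xu s \<omega>) :: real)"
      by (rule birth_death_process.path_set_integrable[OF walk \<omega> t, where v = 1]) (simp add: indicator_def)
    have "(LBINT s:{0..t}. ?V (Xu s \<omega>)) = (LBINT s:{0..t}. c) + (LBINT s:{0..t}. r * indicator {0} (Xu s \<omega>))"
      using int birth_death_process.path_set_integrable[OF walk \<omega> t, of "\<lambda>_. c" c] c
      by (intro set_integral_add set_integrable_mult_right) auto
    also have "\<dots> = t * c + r * ?I \<omega>"
      using t by (simp add: set_lebesgue_integral_def)
    finally show "1 / u (Xu t \<omega>) * exp (- (LBINT s:{0..t}. ?V (Xu s \<omega>)))
        = exp (- t * c) * (1 / u (Xu t \<omega>) * exp (- r * ?I \<omega>))"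
      by (simp add: exp_diff exp_minus field_simps)
  qed simp
  also have "\<dots> = exp (- t * c) * ?E"
    by (rule integral_mult_right_zero)
  finally show ?thesis unfolding c_def r_def by simp
qed

lemma (in prob_space) expectation_discounted_le_1:
  fixes u :: "nat \<Rightarrow> real" and Y :: "real \<Rightarrow> 'a \<Rightarrow> nat"
  assumes u: "\<And>y. 1 \<le> u y" and r: "0 \<le> r"
  shows "expectation (\<lambda>\<omega>. 1 / u (Y t \<omega>) * exp (- r * (LBINT s:{0..t}. indicator {0} (Y s \<omega>)))) \<le> 1"
    (is "expectation ?f \<le> 1")
proof (cases "integrable M ?f")
  case True
  have "0 \<le> (LBINT s:{0..t}. indicator {0} (Y s \<omega>) :: real)" for \<omega>
    unfolding set_lebesgue_integral_def by (intro integral_nonneg_AE) auto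
  moreover have "0 < u y" for y using u[of y] by linarith
  ultimately show ?thesis
    using u r by (intro integral_le_const[OF True] AE_I2 mult_le_one) auto
qed (simp add: not_integrable_integral_eq)

theorem corollary3p12:
  fixes lam nu t :: real and x :: nat and u :: "nat \<Rightarrow> real"
    and M :: "'a measure" and X :: "real \<Rightarrow> 'a \<Rightarrow> nat"
    and N :: "'b measure" and Xu :: "real \<Rightarrow> 'b \<Rightarrow> nat"
  assumes lam_pos: "0 < lam" and lam_less_nu: "lam < nu"
    and u_def: "\<And>y. u y = (nu / lam) powr (real y / 2)"
    and X: "birth_death_process M (mm1_birth lam) (mm1_death nu) (x + 1) X"
    and Xu: "birth_death_process N
               (modified_birth u (mm1_birth lam)) (modified_death u (mm1_death nu)) x Xu"
    and t: "0 \<le> t"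
  shows "measure M {\<omega> \<in> space M. hitting_time_0 X \<omega> > ereal t} =
           u x * exp (- t * (sqrt lam - sqrt nu)\<^sup>2) *
           (\<integral>\<omega>. 1 / u (Xu t \<omega>) *
                exp (- sqrt (lam * nu) * (LBINT s:{0..t}. indicator {0} (Xu s \<omega>))) \<partial>N)
       \<and> u x * exp (- t * (sqrt lam - sqrt nu)\<^sup>2) *
           (\<integral>\<omega>. 1 / u (Xu t \<omega>) *
                exp (- sqrt (lam * nu) * (LBINT s:{0..t}. indicator {0} (Xu s \<omega>))) \<partial>N)
         \<le> u x * exp (- t * (sqrt lam - sqrt nu)\<^sup>2)"
  by (rule conjI[OF mm1_survival_probability[OF assms] mult_left_le[OF
        prob_space.expectation_discounted_le_1[OF birth_death_process.axioms(1)[OF Xu]]]])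
    (use lam_pos lam_less_nu in \<open>auto simp: u_def intro!: ge_one_powr_ge_zero mult_nonneg_nonneg\<close>)

end
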